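(* A $6$-dimensional non-abelian nilpotent real Lie algebra $\mathfrak g$ admits an LCSKT structure $(J,g)$ if and only if $\mathfrak g$ is isomorphic either to $\mathfrak h_8=(0,0,0,0,0,12)$ or to $\mathfrak h_{16}=(0,0,0,12,14,24)$. Moreover, if $\mathfrak g\cong\mathfrak h_8$, the underlying complex structure $J$ must be abelian and every LCSKT structure is trivial. If $\mathfrak g\cong\mathfrak h_{16}$, the complex structure $J$ has to be nilpotent and non-abelian, and every LCSKT structure is non-trivial.
   Context: Notation: $(0,0,0,0,0,12)$ denotes the real Lie algebra having a basis $\{e^1,\dots,e^6\}$ of $\mathfrak g^*$ with $de^k=0$ for $k\le5$ and $de^6=e^1\wedge e^2$; similarly $(0,0,0,12,14,24)$ means $de^1=de^2=de^3=0$, $de^4=e^1\wedge e^2$, $de^5=e^1\wedge e^4$, $de^6=e^2\wedge e^4$, where $d$ is the Chevalley–Eilenberg differential. A complex structure on $\mathfrak g$ is an endomorphism $J$ with $J^2=-\mathrm{Id}$ and $[JX,JY]-J[JX,Y]-J[X,JY]-[X,Y]=0$ for all $X,Y$. It is abelian if $[JX,JY]=[X,Y]$ for all $X,Y$. On a $2n$-dimensional nilpotent Lie algebra it is called nilpotent if there is a basis $\{\omega^j\}_{j=1}^n$ of $(1,0)$-forms with $d\omega^1=0$ and $d\omega^j\in\Lambda^2\langle\omega^1,\dots,\omega^{j-1},\overline\omega^1,\dots,\overline\omega^{j-1}\rangle$ for $j\ge2$. A Hermitian structure $(J,g)$ is a complex structure $J$ together with an inner product $g$ with $g(JX,JY)=g(X,Y)$.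 Its fundamental form is $\Omega(X,Y)=g(JX,Y)$ and its Bismut torsion $3$-form is $H=d^c\Omega$, i.e. $H(X,Y,Z)=-d\Omega(JX,JY,JZ)$. $(J,g)$ is LCSKT if there is a non-zero closed $1$-form $\alpha$ on $\mathfrak g$ with $dH=\alpha\wedge H$. An LCSKT structure is trivial if $dH=0$ and non-trivial if $dH\neq0$. *)

theory Defs
  imports "HOL-Analysis.Analysis"
begin

section \<open>Real Lie algebras\<close>

locale lie_algebra =
  fixes br :: "'a::real_vector \<Rightarrow> 'a \<Rightarrow> 'a"
  assumes bilinear_br: "bilinear br"
    and br_self: "br x x = 0"
    and jacobi: "br x (br y z) + br y (br z x) + br z (br x y) = 0"

definition abelian_lie :: "('a::real_vector \<Rightarrow> 'a \<Rightarrow> 'a) \<Rightarrow> bool" where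
  "abelian_lie br \<longleftrightarrow> (\<forall>x y. br x y = 0)"

primrec lower_central :: "('a::real_vector \<Rightarrow> 'a \<Rightarrow> 'a) \<Rightarrow> nat \<Rightarrow> 'a set" where
  "lower_central br 0 = UNIV"
| "lower_central br (Suc k) = span {br x y |x y. y \<in> lower_central br k}"

definition nilpotent_lie :: "('a::real_vector \<Rightarrow> 'a \<Rightarrow> 'a) \<Rightarrow> bool" where
  "nilpotent_lie br \<longleftrightarrow> (\<exists>k. lower_central br k = {0})"

definition lie_isomorphic ::
  "('a::real_vector \<Rightarrow> 'a \<Rightarrow> 'a) \<Rightarrow> ('b::real_vector \<Rightarrow> 'b \<Rightarrow> 'b) \<Rightarrow> bool" where
  "lie_isomorphic br br' \<longleftrightarrow>
     (\<exists>f. linear f \<and> bij f \<and> (\<forall>x y. f (br x y) = br' (f x) (f y)))"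

section \<open>Forms and the Chevalley--Eilenberg differential\<close>

text \<open>
  A \<open>k\<close>-form is a curried function of \<open>k\<close> vectors. On a \<open>k\<close>-form the differential is
  \<open>d\<omega>(X\<^sub>0,\<dots>,X\<^sub>k) = \<Sum>\<^sub>i\<^sub><\<^sub>j (-1)\<^sup>i\<^sup>+\<^sup>j \<omega>([X\<^sub>i,X\<^sub>j],X\<^sub>0,\<dots>,X\<^sub>k)\<close> with \<open>X\<^sub>i\<close> and \<open>X\<^sub>j\<close> omitted from the
  remaining arguments; below it is written out for \<open>k = 1, 2, 3\<close>. Wedge products carry no
  factorial normalisation, so that \<open>(\<alpha> \<and> \<beta>)(X,Y) = \<alpha>(X)\<beta>(Y) - \<alpha>(Y)\<beta>(X)\<close>. The value type is
  left open because both real and complex forms occur.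
\<close>

definition d1 :: "('a \<Rightarrow> 'a \<Rightarrow> 'a) \<Rightarrow> ('a \<Rightarrow> 'b::ab_group_add) \<Rightarrow> 'a \<Rightarrow> 'a \<Rightarrow> 'b" where
  "d1 br \<alpha> = (\<lambda>x y. - \<alpha> (br x y))"

definition d2 ::
  "('a \<Rightarrow> 'a \<Rightarrow> 'a) \<Rightarrow> ('a \<Rightarrow> 'a \<Rightarrow> 'b::ab_group_add) \<Rightarrow> 'a \<Rightarrow> 'a \<Rightarrow> 'a \<Rightarrow> 'b" where
  "d2 br \<beta> = (\<lambda>x y z. - \<beta> (br x y) z + \<beta> (br x z) y - \<beta> (br y z) x)"

definition d3 ::
  "('a \<Rightarrow> 'a \<Rightarrow> 'a) \<Rightarrow> ('a \<Rightarrow> 'a \<Rightarrow> 'a \<Rightarrow> 'b::ab_group_add) \<Rightarrow> 'a \<Rightarrow> 'a \<Rightarrow> 'a \<Rightarrow> 'a \<Rightarrow> 'b" where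
  "d3 br \<gamma> = (\<lambda>x y z w.
     - \<gamma> (br x y) z w + \<gamma> (br x z) y w - \<gamma> (br x w) y z
     - \<gamma> (br y z) x w + \<gamma> (br y w) x z - \<gamma> (br z w) x y)"

definition wedge11 :: "('a \<Rightarrow> 'b::comm_ring) \<Rightarrow> ('a \<Rightarrow> 'b) \<Rightarrow> 'a \<Rightarrow> 'a \<Rightarrow> 'b" where
  "wedge11 \<alpha> \<beta> = (\<lambda>x y. \<alpha> x * \<beta> y - \<alpha> y * \<beta> x)"

definition wedge13 ::
  "('a \<Rightarrow> 'b::comm_ring) \<Rightarrow> ('a \<Rightarrow> 'a \<Rightarrow> 'a \<Rightarrow> 'b) \<Rightarrow> 'a \<Rightarrow> 'a \<Rightarrow> 'a \<Rightarrow> 'a \<Rightarrow> 'b" where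
  "wedge13 \<alpha> \<gamma> = (\<lambda>x y z w. \<alpha> x * \<gamma> y z w - \<alpha> y * \<gamma> x z w + \<alpha> z * \<gamma> x y w - \<alpha> w * \<gamma> x y z)"

section \<open>The Lie algebras \<open>\<hh>\<^sub>8\<close> and \<open>\<hh>\<^sub>1\<^sub>6\<close>\<close>

text \<open>
  Here \<open>e\<^sup>k\<close> is the \<open>k\<close>-th coordinate on \<open>\<real>\<^sup>6\<close>. Since \<open>de\<^sup>k(X,Y) = -e\<^sup>k([X,Y])\<close>, the components
  of the bracket are the negatives of the prescribed 2-forms \<open>de\<^sup>k\<close>; the structure equations
  themselves are verified afterwards.
\<close>

definition coform :: "6 \<Rightarrow> real^6 \<Rightarrow> real" where
  "coform k = (\<lambda>x. x $ k)"

definition h8 :: "real^6 \<Rightarrow> real^6 \<Rightarrow> real^6" where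
  "h8 x y = (\<chi> k. if k = 6 then - wedge11 (coform 1) (coform 2) x y else 0)"

definition h16 :: "real^6 \<Rightarrow> real^6 \<Rightarrow> real^6" where
  "h16 x y = (\<chi> k. if k = 4 then - wedge11 (coform 1) (coform 2) x y
                   else if k = 5 then - wedge11 (coform 1) (coform 4) x y
                   else if k = 6 then - wedge11 (coform 2) (coform 4) x y
                   else 0)"

lemma h8_structure_equations:
  "k \<in> {1, 2, 3, 4, 5} \<Longrightarrow> d1 h8 (coform k) = (\<lambda>x y. 0)"
  "d1 h8 (coform 6) = wedge11 (coform 1) (coform 2)"
  by (auto simp: d1_def h8_def coform_def)

lemma h16_structure_equations:
  "k \<in> {1, 2, 3} \<Longrightarrow> d1 h16 (coform k) = (\<lambda>x y. 0)"
  "d1 h16 (coform 4) = wedge11 (coform 1) (coform 2)"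
  "d1 h16 (coform 5) = wedge11 (coform 1) (coform 4)"
  "d1 h16 (coform 6) = wedge11 (coform 2) (coform 4)"
  by (auto simp: d1_def h16_def coform_def)

lemma lie_algebra_h8: "lie_algebra h8"
  by unfold_locales
    (auto simp: bilinear_def h8_def coform_def wedge11_def vec_eq_iff algebra_simps intro!: linearI)

lemma lie_algebra_h16: "lie_algebra h16"
  by unfold_locales
    (auto simp: bilinear_def h16_def coform_def wedge11_def vec_eq_iff algebra_simps intro!: linearI)

section \<open>Complex structures\<close>

definition complex_structure ::
  "('a::real_vector \<Rightarrow> 'a \<Rightarrow> 'a) \<Rightarrow> ('a \<Rightarrow> 'a) \<Rightarrow> bool" where
  "complex_structure br J \<longleftrightarrow>
     linear J \<and> (\<forall>x. J (J x) = - x) \<and>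
     (\<forall>x y. br (J x) (J y) - J (br (J x) y) - J (br x (J y)) - br x y = 0)"

definition abelian_complex_structure ::
  "('a::real_vector \<Rightarrow> 'a \<Rightarrow> 'a) \<Rightarrow> ('a \<Rightarrow> 'a) \<Rightarrow> bool" where
  "abelian_complex_structure br J \<longleftrightarrow>
     complex_structure br J \<and> (\<forall>x y. br (J x) (J y) = br x y)"

text \<open>
  Complex-valued 1-forms are the real-linear maps into \<open>\<complex>\<close>; those of type \<open>(1,0)\<close> are the ones
  whose complexification vanishes on all \<open>X + i JX\<close>.
\<close>

definition forms10 :: "('a::real_vector \<Rightarrow> 'a) \<Rightarrow> ('a \<Rightarrow> complex) set" where
  "forms10 J = {\<theta>. linear \<theta> \<and> (\<forall>x. \<theta> (J x) = \<i> * \<theta> x)}"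

definition basis_forms10 ::
  "('a::real_vector \<Rightarrow> 'a) \<Rightarrow> nat \<Rightarrow> (nat \<Rightarrow> 'a \<Rightarrow> complex) \<Rightarrow> bool" where
  "basis_forms10 J n \<omega> \<longleftrightarrow>
     (\<forall>j\<in>{1..n}. \<omega> j \<in> forms10 J) \<and>
     (\<forall>c. (\<forall>x. (\<Sum>j=1..n. c j * \<omega> j x) = 0) \<longrightarrow> (\<forall>j\<in>{1..n}. c j = 0)) \<and>
     (\<forall>\<theta>\<in>forms10 J. \<exists>c. \<forall>x. \<theta> x = (\<Sum>j=1..n. c j * \<omega> j x))"

text \<open>The second exterior power of the complex span of a finite set \<open>S\<close> of 1-forms.\<close>

definition Lambda2 :: "('a \<Rightarrow> complex) set \<Rightarrow> ('a \<Rightarrow> 'a \<Rightarrow> complex) set" where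
  "Lambda2 S = {\<beta>. \<exists>c. \<beta> = (\<lambda>x y. \<Sum>\<theta>\<in>S. \<Sum>\<eta>\<in>S. c \<theta> \<eta> * wedge11 \<theta> \<eta> x y)}"

definition nilpotent_complex_structure ::
  "('a::real_vector \<Rightarrow> 'a \<Rightarrow> 'a) \<Rightarrow> ('a \<Rightarrow> 'a) \<Rightarrow> bool" where
  "nilpotent_complex_structure br J \<longleftrightarrow>
     complex_structure br J \<and>
     (\<exists>n \<omega>. dim (UNIV :: 'a set) = 2 * n \<and> basis_forms10 J n \<omega> \<and>
        d1 br (\<omega> 1) = (\<lambda>x y. 0) \<and>
        (\<forall>j\<in>{2..n}. d1 br (\<omega> j) \<in> Lambda2 (\<omega> ` {1..<j} \<union> (\<lambda>i. cnj \<circ> \<omega> i) ` {1..<j})))"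

section \<open>Hermitian and LCSKT structures\<close>

definition inner_product :: "('a::real_vector \<Rightarrow> 'a \<Rightarrow> real) \<Rightarrow> bool" where
  "inner_product g \<longleftrightarrow>
     bilinear g \<and> (\<forall>x y. g x y = g y x) \<and> (\<forall>x. x \<noteq> 0 \<longrightarrow> g x x > 0)"

definition hermitian_structure ::
  "('a::real_vector \<Rightarrow> 'a \<Rightarrow> 'a) \<Rightarrow> ('a \<Rightarrow> 'a) \<Rightarrow> ('a \<Rightarrow> 'a \<Rightarrow> real) \<Rightarrow> bool" where
  "hermitian_structure br J g \<longleftrightarrow>
     complex_structure br J \<and> inner_product g \<and> (\<forall>x y. g (J x) (J y) = g x y)"

definition fundamental_form ::
  "('a \<Rightarrow> 'a) \<Rightarrow> ('a \<Rightarrow> 'a \<Rightarrow> real) \<Rightarrow> 'a \<Rightarrow> 'a \<Rightarrow> real" where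
  "fundamental_form J g = (\<lambda>x y. g (J x) y)"

definition bismut_torsion ::
  "('a \<Rightarrow> 'a \<Rightarrow> 'a) \<Rightarrow> ('a \<Rightarrow> 'a) \<Rightarrow> ('a \<Rightarrow> 'a \<Rightarrow> real) \<Rightarrow> 'a \<Rightarrow> 'a \<Rightarrow> 'a \<Rightarrow> real" where
  "bismut_torsion br J g = (\<lambda>x y z. - d2 br (fundamental_form J g) (J x) (J y) (J z))"

definition lcskt ::
  "('a::real_vector \<Rightarrow> 'a \<Rightarrow> 'a) \<Rightarrow> ('a \<Rightarrow> 'a) \<Rightarrow> ('a \<Rightarrow> 'a \<Rightarrow> real) \<Rightarrow> bool" where
  "lcskt br J g \<longleftrightarrow>
     hermitian_structure br J g \<and>
     (\<exists>\<alpha> :: 'a \<Rightarrow> real. linear \<alpha> \<and> \<alpha> \<noteq> (\<lambda>x. 0) \<and> d1 br \<alpha> = (\<lambda>x y. 0) \<and>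
        d3 br (bismut_torsion br J g) = wedge13 \<alpha> (bismut_torsion br J g))"

definition trivial_lcskt ::
  "('a::real_vector \<Rightarrow> 'a \<Rightarrow> 'a) \<Rightarrow> ('a \<Rightarrow> 'a) \<Rightarrow> ('a \<Rightarrow> 'a \<Rightarrow> real) \<Rightarrow> bool" where
  "trivial_lcskt br J g \<longleftrightarrow>
     lcskt br J g \<and> d3 br (bismut_torsion br J g) = (\<lambda>x y z w. 0)"

definition nontrivial_lcskt ::
  "('a::real_vector \<Rightarrow> 'a \<Rightarrow> 'a) \<Rightarrow> ('a \<Rightarrow> 'a) \<Rightarrow> ('a \<Rightarrow> 'a \<Rightarrow> real) \<Rightarrow> bool" where
  "nontrivial_lcskt br J g \<longleftrightarrow>
     lcskt br J g \<and> d3 br (bismut_torsion br J g) \<noteq> (\<lambda>x y z w. 0)"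

end

theory Submission
  imports Defs
begin

text \<open>
  For a Hermitian structure the torsion is the cyclic sum
  \<open>H(X,Y,Z) = g([JX,JY],Z) + g([JY,JZ],X) + g([JZ,JX],Y)\<close>. Nilpotency makes the bracket
  triangular, and the equation \<open>dH = \<alpha> \<and> H\<close>, evaluated where many brackets vanish, then leaves
  so little room that the whole bracket can be written down.

  A nilpotent Lie algebra with a complex structure has a closed \<open>(1,0)\<close>-form
  (\<open>closed_10_form\<close>): some unit vector \<open>e\<close> is such that \<open>e\<close> and \<open>Je\<close> are orthogonal to all
  brackets. Let \<open>K\<close> be the orthogonal complement of \<open>e, Je\<close>, an ideal of dimension 4.

  Suppose that \<open>K\<close> is abelian. Then \<open>H\<close> vanishes on \<open>K\<close>, and on \<open>K\<close> the forms \<open>H(e,\<cdot>,\<cdot>)\<close> and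
  \<open>H(Je,\<cdot>,\<cdot>)\<close> are, up to a factor, the skew parts of \<open>ad(Je) \<circ> J\<close> and \<open>ad(e) \<circ> J\<close>. The equation on
  \<open>(e,y,z,w)\<close> says that \<open>\<alpha>\<close> restricted to \<open>K\<close> wedges both forms to zero. On \<open>(e,Je,y,z)\<close> the
  contraction of \<open>dH\<close> with \<open>J\<close> is the sum of the squares of the entries of the two forms; if \<open>\<alpha>\<close>
  vanishes on \<open>K\<close>, that of \<open>\<alpha> \<and> H\<close> is a combination of the traces of the nilpotent maps \<open>ad(e)\<close> and
  \<open>ad(Je)\<close>, hence zero, and both forms vanish. In either case a central vector
  \<open>x\<close> in the derived algebra has \<open>Jx\<close> central too (\<open>complex_central_line\<close>), and \<open>ad(e)\<close> and
  \<open>ad(Je)\<close> map \<open>K\<close> into the span \<open>L\<close> of \<open>x\<close> and \<open>Jx\<close> (\<open>nilpotent_on_complex_line\<close>). Either they kill \<open>K\<close>, and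
  \<open>[e,Je]\<close> spans all brackets, or \<open>K = L + \<langle>p,Jp\<rangle>\<close> with \<open>p\<close> dual to \<open>\<alpha>\<close>; then \<open>[e,Jp] = w\<close> and
  \<open>[Je,Jp] = Jw\<close> are the only other brackets, and \<open>2|w|\<^sup>2 = \<alpha>(p) g([e,Je],Jp)\<close> forces \<open>[e,Je]\<close> to
  have a component along \<open>Jp\<close>.

  If \<open>K\<close> is not abelian, one more step of the filtration shows that all brackets lie in a central
  complex line on which \<open>\<alpha>\<close> vanishes. The equation with one entry in that line makes the bracket
  decomposable with factor \<open>\<alpha> \<circ> J\<close>, and the remaining component is a norm that must vanish; once more
  a single bracket spans the derived algebra (\<open>derived_in_central_line\<close>).

  The two normal forms are those of \<open>\<hh>\<^sub>8\<close> and \<open>\<hh>\<^sub>1\<^sub>6\<close>, given with the position of \<open>J\<close> and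
  \<open>g\<close> (\<open>bracket_normal_form\<close>). All assertions on \<open>J\<close> and \<open>dH\<close> are read off from them, explicit structures on
  \<open>\<real>\<^sup>6\<close> give the converse, and the nilpotency step tells the two algebras apart.
\<close>

section \<open>Hermitian structures on six-dimensional nilpotent Lie algebras\<close>

locale hermitian_nilpotent = lie_algebra br
  for br :: "'a::real_vector \<Rightarrow> 'a \<Rightarrow> 'a" +
  fixes J :: "'a \<Rightarrow> 'a" and g :: "'a \<Rightarrow> 'a \<Rightarrow> real"
  assumes hermitian: "hermitian_structure br J g"
    and nilpotent: "nilpotent_lie br"
    and dim_six: "dim (UNIV :: 'a set) = 6"
begin

lemma linear_J: "linear J" and bilinear_g: "bilinear g"
  using hermitian by (auto simp: hermitian_structure_def complex_structure_def inner_product_def)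

lemma J_J [simp]: "J (J x) = - x"
  and integrable: "br (J x) (J y) - br x y = J (br (J x) y) + J (br x (J y))"
  and g_sym: "g x y = g y x"
  and g_pos: "x \<noteq> 0 \<Longrightarrow> g x x > 0"
  and g_J_J [simp]: "g (J x) (J y) = g x y"
proof -
  have "br (J x) (J y) - J (br (J x) y) - J (br x (J y)) - br x y = 0"
    using hermitian by (simp add: hermitian_structure_def complex_structure_def)
  then show "br (J x) (J y) - br x y = J (br (J x) y) + J (br x (J y))"
    by (simp add: algebra_simps)
qed (use hermitian in \<open>auto simp: hermitian_structure_def complex_structure_def inner_product_def\<close>)

lemmas J_lin [simp] = linear_add [OF linear_J] linear_diff [OF linear_J]
  linear_neg [OF linear_J] linear_scale [OF linear_J] linear_0 [OF linear_J]
lemmas g_lin [simp] =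
  bilinear_ladd [OF bilinear_g] bilinear_radd [OF bilinear_g]
  bilinear_lsub [OF bilinear_g] bilinear_rsub [OF bilinear_g]
  bilinear_lneg [OF bilinear_g] bilinear_rneg [OF bilinear_g]
  bilinear_lmul [OF bilinear_g, simplified] bilinear_rmul [OF bilinear_g, simplified]
  bilinear_lzero [OF bilinear_g] bilinear_rzero [OF bilinear_g]
lemmas br_lin [simp] =
  bilinear_ladd [OF bilinear_br] bilinear_radd [OF bilinear_br]
  bilinear_lsub [OF bilinear_br] bilinear_rsub [OF bilinear_br]
  bilinear_lneg [OF bilinear_br] bilinear_rneg [OF bilinear_br]
  bilinear_lmul [OF bilinear_br] bilinear_rmul [OF bilinear_br]
  bilinear_lzero [OF bilinear_br] bilinear_rzero [OF bilinear_br]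
declare br_self [simp]

lemma br_swap: "br y x = - br x y"
proof -
  have "br x (x + y) + br y (x + y) = 0"
    using br_self[of "x + y"] by (simp only: bilinear_ladd [OF bilinear_br])
  then have "br y x + br x y = 0" by (simp add: add.commute)
  then show ?thesis by (simp add: eq_neg_iff_add_eq_0)
qed

lemma g_J_left: "g (J x) y = - g x (J y)"
  using g_J_J[of x "J y"] by simp

lemma g_J_self [simp]: "g x (J x) = 0" "g (J x) x = 0"
  using g_J_left[of x x] g_sym[of x "J x"] by auto

lemma g_eq_0_iff [simp]: "g x x = 0 \<longleftrightarrow> x = 0"
  using g_pos[of x] by force

lemma J_eq_0_iff [simp]: "J x = 0 \<longleftrightarrow> x = 0"
  by (metis J_J J_lin(5) neg_equal_0_iff_equal)

lemma g_sum_left: "finite S \<Longrightarrow> g (\<Sum>s\<in>S. f s) y = (\<Sum>s\<in>S. g (f s) y)"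
  by (induction S rule: finite_induct) auto

lemma br_sum_right: "finite S \<Longrightarrow> br z (\<Sum>s\<in>S. f s) = (\<Sum>s\<in>S. br z (f s))"
  by (induction S rule: finite_induct) auto

definition orthonormal :: "'a set \<Rightarrow> bool" where
  "orthonormal S \<longleftrightarrow> (\<forall>x\<in>S. \<forall>y\<in>S. g x y = (if x = y then 1 else 0))"

definition expands :: "'a set \<Rightarrow> 'a set \<Rightarrow> bool" where
  "expands S V \<longleftrightarrow> (\<forall>x\<in>V. x = (\<Sum>s\<in>S. g x s *\<^sub>R s))"

lemma expandsD: "expands S V \<Longrightarrow> x \<in> V \<Longrightarrow> x = (\<Sum>s\<in>S. g x s *\<^sub>R s)"
  unfolding expands_def by (rule bspec)

lemma expands_span:
  assumes "expands S V" "x \<in> V" shows "x \<in> span S"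
proof -
  have "(\<Sum>s\<in>S. g x s *\<^sub>R s) \<in> span S" by (intro span_sum span_scale span_base)
  then show ?thesis by (rule back_subst[of "\<lambda>z. z \<in> span S", OF _ expandsD[OF assms, symmetric]])
qed

lemma g_span_0: "y \<in> span S \<Longrightarrow> (\<And>s. s \<in> S \<Longrightarrow> g s x = 0) \<Longrightarrow> g y x = 0"
  by (induction rule: span_induct_alt) auto

lemma finite_basis:
  obtains B :: "'a set" where "finite B" "independent B" "card B = 6" "span B = UNIV"
proof -
  obtain B :: "'a set" where "independent B" "UNIV \<subseteq> span B" "card B = dim (UNIV :: 'a set)"
    using basis_exists by blast
  then show ?thesis using dim_six card.infinite[of B] by (intro that[of B]) auto
qed

lemma orthonormal_card:
  assumes "orthonormal S" shows "finite S \<and> card S \<le> 6"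
proof -
  have "independent S"
    unfolding dependent_def
  proof
    assume "\<exists>a\<in>S. a \<in> span (S - {a})"
    then obtain a where a: "a \<in> S" "a \<in> span (S - {a})" by blast
    then have "g a a = 0"
      using assms by (intro g_span_0[OF a(2)]) (auto simp: orthonormal_def)
    with a assms show False by (auto simp: orthonormal_def)
  qed
  then show ?thesis using finite_basis independent_span_bound by (metis top_greatest)
qed

lemma normalize:
  assumes "r \<noteq> 0" obtains t where "t > 0" "g (t *\<^sub>R r) (t *\<^sub>R r) = 1"
  using g_pos[OF assms] by (intro that[of "1 / sqrt (g r r)"]) (auto simp: field_simps)

text \<open>An orthonormal subset of \<open>V\<close> of largest size expands all of \<open>V\<close>: otherwise the normalised
  remainder of a vector that is not expanded could be added.\<close>
lemma orthonormal_extend: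
  assumes "orthonormal S" "S \<subseteq> V" "subspace V"
  obtains S' where "S \<subseteq> S'" "S' \<subseteq> V" "orthonormal S'" "expands S' V"
proof -
  let ?P = "\<lambda>T. S \<subseteq> T \<and> T \<subseteq> V \<and> orthonormal T"
  have "\<exists>T. ?P T \<and> (\<forall>U. ?P U \<longrightarrow> card U \<le> card T)"
  proof (rule ex_has_greatest_nat[of ?P S card 7])
    show "?P S" using assms by blast
    show "\<forall>T. ?P T \<longrightarrow> card T < 7" using orthonormal_card by fastforce
  qed
  then obtain T where T: "?P T" and max: "\<And>U. ?P U \<Longrightarrow> card U \<le> card T" by blast
  have fin: "finite T" using T orthonormal_card by blast
  have "x = (\<Sum>s\<in>T. g x s *\<^sub>R s)" if "x \<in> V" for x
  proof (rule ccontr)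
    assume ne: "x \<noteq> (\<Sum>s\<in>T. g x s *\<^sub>R s)"
    define r where "r = x - (\<Sum>s\<in>T. g x s *\<^sub>R s)"
    have r0: "r \<noteq> 0" using ne by (simp add: r_def)
    have orth: "g r t = 0" if "t \<in> T" for t
    proof -
      have "(\<Sum>s\<in>T. g x s * g s t) = (\<Sum>s\<in>T. if s = t then g x s else 0)"
        by (rule sum.cong) (use T that in \<open>auto simp: orthonormal_def\<close>)
      then show ?thesis using that fin by (simp add: r_def g_sum_left)
    qed
    obtain t where t: "t > 0" "g (t *\<^sub>R r) (t *\<^sub>R r) = 1" using normalize[OF r0] by blast
    define q where "q = t *\<^sub>R r"
    have q: "g q q = 1" using t by (simp only: q_def)
    have qT: "g q s = 0" "g s q = 0" if "s \<in> T" for s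
      using orth[OF that] g_sym[of s r] by (simp_all add: q_def)
    have "q \<in> V" using that T assms(3) unfolding q_def r_def
      by (intro subspace_scale subspace_diff subspace_sum) auto
    moreover have "orthonormal (insert q T)"
      using T q qT unfolding orthonormal_def by auto
    moreover have "q \<notin> T" using qT[of q] q by auto
    ultimately have "card (insert q T) = Suc (card T)" "?P (insert q T)"
      using T fin by auto
    then show False using max[of "insert q T"] by simp
  qed
  then have "expands T V" unfolding expands_def by (rule ballI)
  with T show ?thesis by (intro that[of T]) auto
qed

lemma expands_UNIV_card:
  assumes "orthonormal S" "expands S UNIV" shows "card S = 6"
proof -
  obtain B :: "'a set" where B: "independent B" "card B = 6" using finite_basis by blast
  have fin: "finite S" "card S \<le> 6" using assms orthonormal_card by auto
  have "B \<subseteq> span S" using expands_span[OF assms(2)] by blast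
  then show ?thesis using independent_span_bound[OF fin(1) B(1)] B(2) fin by simp
qed

lemma orthogonal_residue:
  assumes "subspace V" "v \<notin> V"
  obtains r where "r \<noteq> 0" "v - r \<in> V" "\<And>s. s \<in> V \<Longrightarrow> g s r = 0"
proof -
  obtain S where S: "S \<subseteq> V" "orthonormal S" "expands S V"
    using orthonormal_extend[of "{}" V] assms by (auto simp: orthonormal_def)
  have fin: "finite S" using S orthonormal_card by blast
  define p where "p = (\<Sum>s\<in>S. g v s *\<^sub>R s)"
  have p: "p \<in> V" unfolding p_def using S assms(1) by (intro subspace_sum subspace_scale) auto
  have orth: "g t (v - p) = 0" if "t \<in> S" for t
  proof -
    have "(\<Sum>s\<in>S. g v s * g s t) = (\<Sum>s\<in>S. if s = t then g v s else 0)"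
      by (rule sum.cong) (use S that in \<open>auto simp: orthonormal_def\<close>)
    then have "g p t = g v t" using that fin by (simp add: p_def g_sum_left)
    then show ?thesis by (simp add: g_sym[of t])
  qed
  show ?thesis
  proof (rule that[of "v - p"])
    fix s assume "s \<in> V"
    with S have "s \<in> span S" by (intro expands_span)
    then show "g s (v - p) = 0" using orth by (rule g_span_0)
  qed (use p assms in auto)
qed

text \<open>With \<open>J\<close> orthogonal, these nine equations make \<open>a, Ja, b, Jb, c, Jc\<close> orthonormal.\<close>
definition unitary_frame :: "'a \<Rightarrow> 'a \<Rightarrow> 'a \<Rightarrow> bool" where
  "unitary_frame a b c \<longleftrightarrow> g a a = 1 \<and> g b b = 1 \<and> g c c = 1 \<and>
     g a b = 0 \<and> g a (J b) = 0 \<and> g a c = 0 \<and> g a (J c) = 0 \<and> g b c = 0 \<and> g b (J c) = 0"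

lemma unitary_frame_g:
  assumes "unitary_frame a b c"
  shows "g a a = 1" "g b b = 1" "g c c = 1"
    "g a b = 0" "g a (J b) = 0" "g a c = 0" "g a (J c) = 0" "g b c = 0" "g b (J c) = 0"
    "g b a = 0" "g (J b) a = 0" "g c a = 0" "g (J c) a = 0" "g c b = 0" "g (J c) b = 0"
    "g b (J a) = 0" "g (J a) b = 0" "g c (J a) = 0" "g (J a) c = 0" "g c (J b) = 0" "g (J b) c = 0"
  using assms unfolding unitary_frame_def
  by (simp_all add: g_sym[of b a] g_sym[of c a] g_sym[of c b]
    g_sym[of "J b" a] g_sym[of "J c" a] g_sym[of "J c" b]
    g_sym[of b "J a"] g_sym[of c "J a"] g_sym[of c "J b"]
    g_J_left[of a b] g_J_left[of a c] g_J_left[of b c])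

lemma frame_orthonormal:
  assumes "unitary_frame a b c"
  shows "orthonormal {a, J a, b, J b, c, J c}" "distinct [a, J a, b, J b, c, J c]"
proof -
  note F = unitary_frame_g[OF assms]
  have ne: "x \<noteq> y" if "g x x = 1" "g x y = 0" for x y
    using that by auto
  have d: "a \<noteq> J a" "a \<noteq> b" "a \<noteq> J b" "a \<noteq> c" "a \<noteq> J c" "J a \<noteq> b" "J a \<noteq> J b" "J a \<noteq> c" "J a \<noteq> J c"
    "b \<noteq> J b" "b \<noteq> c" "b \<noteq> J c" "J b \<noteq> c" "J b \<noteq> J c" "c \<noteq> J c"
    by (rule ne; simp add: F)+
  then show "distinct [a, J a, b, J b, c, J c]" by simp
  show "orthonormal {a, J a, b, J b, c, J c}"
    unfolding orthonormal_def by (simp add: F d d [symmetric])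
qed

lemma frame_expands:
  assumes "unitary_frame a b c"
  shows "expands {a, J a, b, J b, c, J c} UNIV"
proof -
  let ?F = "{a, J a, b, J b, c, J c}"
  obtain S where S: "?F \<subseteq> S" "orthonormal S" "expands S UNIV"
    using orthonormal_extend[OF frame_orthonormal(1)[OF assms], of UNIV] by auto
  have "card ?F = 6" using frame_orthonormal(2)[OF assms] by simp
  with S orthonormal_card[OF S(2)] have "?F = S" by (intro card_seteq) auto
  with S show ?thesis by simp
qed

lemma frame_expand:
  assumes "unitary_frame a b c"
  shows "x = g x a *\<^sub>R a + g x (J a) *\<^sub>R J a + g x b *\<^sub>R b + g x (J b) *\<^sub>R J b
    + g x c *\<^sub>R c + g x (J c) *\<^sub>R J c"
proof -
  have "x = (\<Sum>s\<in>{a, J a, b, J b, c, J c}. g x s *\<^sub>R s)"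
    by (rule expandsD [OF frame_expands [OF assms]]) simp
  also have "\<dots> = g x a *\<^sub>R a + g x (J a) *\<^sub>R J a + g x b *\<^sub>R b + g x (J b) *\<^sub>R J b
    + g x c *\<^sub>R c + g x (J c) *\<^sub>R J c"
    using frame_orthonormal(2)[OF assms] by (simp add: add.assoc)
  finally show ?thesis .
qed

text \<open>Four orthonormal vectors do not expand the whole space, so an orthonormal basis containing
  them has a further element; orthogonality to \<open>a, Ja, b, Jb\<close> gives the equations with \<open>J\<close>.\<close>
lemma unitary_frame_complete:
  assumes "g a a = 1" "g b b = 1" "g a b = 0" "g a (J b) = 0"
  obtains c where "unitary_frame a b c"
proof -
  let ?F = "{a, J a, b, J b}"
  have sw: "g b a = 0" "g (J b) a = 0" "g (J a) b = 0" "g b (J a) = 0"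
    using assms g_sym[of a b] g_sym[of a "J b"] g_J_left[of a b] g_sym[of "J a" b] by auto
  have ne: "x \<noteq> y" if "g x x = 1" "g x y = 0" for x y
    using that by auto
  have d: "a \<noteq> J a" "a \<noteq> b" "a \<noteq> J b" "J a \<noteq> b" "J a \<noteq> J b" "b \<noteq> J b"
    by (rule ne; simp add: assms sw)+
  have "orthonormal ?F"
    unfolding orthonormal_def by (simp add: assms sw d d [symmetric])
  then obtain S where S: "?F \<subseteq> S" "orthonormal S" "expands S UNIV"
    using orthonormal_extend[of ?F UNIV] by auto
  have "card ?F < card S" using expands_UNIV_card[OF S(2,3)] d by simp
  then have "\<not> S \<subseteq> ?F" using card_mono[of ?F S] by auto
  then obtain c where c: "c \<in> S" "c \<notin> ?F" by blast
  have "g f c = 0" if "f \<in> ?F" for f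
  proof -
    from that c S have "f \<in> S" "c \<in> S" "f \<noteq> c" by blast+
    with S show ?thesis by (simp add: orthonormal_def)
  qed
  then have "g a c = 0" "g (J a) c = 0" "g b c = 0" "g (J b) c = 0" by simp_all
  moreover have "g c c = 1" using S c by (simp add: orthonormal_def)
  ultimately have "unitary_frame a b c"
    using assms by (simp add: unitary_frame_def g_J_left)
  then show ?thesis by (rule that)
qed

end

section \<open>Nilpotency and invariant complex subspaces\<close>

context hermitian_nilpotent begin

lemma subspace_lower_central: "subspace (lower_central br k)"
  by (cases k) auto

lemma br_lower_central: "y \<in> lower_central br k \<Longrightarrow> br x y \<in> lower_central br (Suc k)"
  by (auto intro!: span_base)

lemma lower_central_decreasing: "lower_central br (Suc k) \<subseteq> lower_central br k"
proof (induction k)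
  case (Suc k)
  then show ?case by (simp only: lower_central.simps(2)) (intro span_mono, auto)
qed simp

lemma br_lower_central_left:
  assumes "x \<in> lower_central br k" shows "br x y \<in> lower_central br (Suc k)"
  using subspace_neg[OF subspace_lower_central br_lower_central[OF assms, of y]] br_swap[of x y] by simp

text \<open>The trace of \<open>ad z\<close> vanishes. Up along the lower central series, orthonormal bases are extended
  one step at a time; since \<open>ad z\<close> sends a step into the next smaller one, the new basis vectors
  contribute nothing. The trace is then carried over to the given frame.\<close>
lemma trace_br:
  assumes "unitary_frame a b c"
  shows "g (br z a) a + g (br z (J a)) (J a) + g (br z b) b + g (br z (J b)) (J b)
    + g (br z c) c + g (br z (J c)) (J c) = 0"
proof -
  obtain N where N: "lower_central br N = {0}" using nilpotent by (auto simp: nilpotent_lie_def)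
  have "\<exists>S. S \<subseteq> lower_central br (N - i) \<and> orthonormal S \<and> expands S (lower_central br (N - i)) \<and>
      (\<Sum>s\<in>S. g (br z s) s) = 0" for i
  proof (induction i)
    case 0
    show ?case by (rule exI[of _ "{}"]) (auto simp: N orthonormal_def expands_def)
  next
    case (Suc i)
    show ?case
    proof (cases "N - i")
      case 0 then show ?thesis using Suc by simp
    next
      case (Suc k)
      then have k: "N - Suc i = k" by simp
      from Suc.IH obtain S where S: "S \<subseteq> lower_central br (Suc k)" "orthonormal S"
        "expands S (lower_central br (Suc k))" "(\<Sum>s\<in>S. g (br z s) s) = 0"
        unfolding \<open>N - i = Suc k\<close> by blast
      obtain T where T: "S \<subseteq> T" "T \<subseteq> lower_central br k" "orthonormal T"
        "expands T (lower_central br k)"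
        using orthonormal_extend[OF S(2) order_trans[OF S(1) lower_central_decreasing]
          subspace_lower_central] by blast
      have fin: "finite T" using T orthonormal_card by blast
      have "g (br z t) t = 0" if t: "t \<in> T - S" for t
      proof -
        have "br z t \<in> lower_central br (Suc k)" using t T by (intro br_lower_central) auto
        then have e: "br z t = (\<Sum>s\<in>S. g (br z t) s *\<^sub>R s)" by (rule expandsD [OF S(3)])
        have "finite S" using fin T finite_subset by blast
        then have "g (br z t) t = (\<Sum>s\<in>S. g (br z t) s * g s t)"
          by (subst e) (simp add: g_sum_left)
        also have "\<dots> = 0"
          by (rule sum.neutral) (use t T in \<open>auto simp: orthonormal_def subset_iff\<close>)
        finally show ?thesis .
      qed
      then have "(\<Sum>s\<in>T. g (br z s) s) = 0"
        using S(4) sum.mono_neutral_right[OF fin T(1), of "\<lambda>s. g (br z s) s"] by simp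
      then show ?thesis using T k by auto
    qed
  qed
  from this[of N] obtain S where S: "orthonormal S" "expands S UNIV" "(\<Sum>s\<in>S. g (br z s) s) = 0"
    by auto
  let ?F = "{a, J a, b, J b, c, J c}"
  have F: "expands ?F UNIV" by (rule frame_expands[OF assms])
  have fin: "finite S" "finite ?F" using S orthonormal_card by auto
  have "(\<Sum>f\<in>?F. g (br z f) f) = (\<Sum>f\<in>?F. \<Sum>s\<in>S. g (br z f) s * g s f)"
  proof (rule sum.cong[OF refl])
    fix f
    have "br z f = (\<Sum>s\<in>S. g (br z f) s *\<^sub>R s)" by (rule expandsD [OF S(2)]) simp
    then have "g (br z f) f = g (\<Sum>s\<in>S. g (br z f) s *\<^sub>R s) f" by simp
    then show "g (br z f) f = (\<Sum>s\<in>S. g (br z f) s * g s f)" by (simp add: g_sum_left fin)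
  qed
  also have "\<dots> = (\<Sum>s\<in>S. \<Sum>f\<in>?F. g (br z f) s * g s f)" by (rule sum.swap)
  also have "\<dots> = (\<Sum>s\<in>S. g (br z s) s)"
  proof (rule sum.cong[OF refl])
    fix s
    have "s = (\<Sum>f\<in>?F. g s f *\<^sub>R f)" by (rule expandsD [OF F]) simp
    then have "g (br z s) s = g (br z (\<Sum>f\<in>?F. g s f *\<^sub>R f)) s" by simp
    also have "\<dots> = (\<Sum>f\<in>?F. g s f * g (br z f) s)"
      by (simp only: br_sum_right[OF fin(2)] g_sum_left[OF fin(2)] br_lin g_lin)
    finally show "(\<Sum>f\<in>?F. g (br z f) s * g s f) = g (br z s) s" by (simp add: mult.commute)
  qed
  finally show ?thesis using S(3) frame_orthonormal(2)[OF assms] by simp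
qed

text \<open>\<open>ad e\<close> has no eigenvalue \<open>t \<noteq> 0\<close> modulo an invariant subspace: an eigenvector would lie, modulo
  \<open>U\<close>, in every term of the lower central series.\<close>
lemma no_eigenvalue:
  assumes "subspace U" "\<And>y. y \<in> U \<Longrightarrow> br e y \<in> U" "br e z - t *\<^sub>R z \<in> U" "t \<noteq> 0"
  shows "z \<in> U"
proof -
  obtain N where N: "lower_central br N = {0}" using nilpotent by (auto simp: nilpotent_lie_def)
  have "\<exists>c\<in>lower_central br k. z - c \<in> U" for k
  proof (induction k)
    case 0 show ?case using subspace_0[OF assms(1)] by (intro bexI[of _ z]) auto
  next
    case (Suc k)
    then obtain c where c: "c \<in> lower_central br k" "z - c \<in> U" by blast
    have "(1 / t) *\<^sub>R (br e (z - c) - (br e z - t *\<^sub>R z)) \<in> U"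
      by (rule subspace_scale[OF assms(1) subspace_diff[OF assms(1) assms(2)[OF c(2)] assms(3)]])
    moreover have "(1 / t) *\<^sub>R (br e (z - c) - (br e z - t *\<^sub>R z)) = z - (1 / t) *\<^sub>R br e c"
      using assms(4) by (simp add: algebra_simps)
    ultimately show ?case
      using subspace_scale[OF subspace_lower_central br_lower_central[OF c(1), of e], of "1 / t"] by metis
  qed
  from this[of N] show ?thesis using N by auto
qed

text \<open>If \<open>M/U\<close> is a complex line (or zero), then \<open>ad e\<close> and \<open>ad Je\<close> act on it as zero. Some \<open>x\<close> outside
  \<open>U\<close> is killed modulo \<open>U\<close> by both, being as deep as possible in the lower central series. If
  \<open>[e,Jx] \<equiv> ax + bJx\<close>, integrability gives \<open>[Je,Jx] \<equiv> aJx - bx\<close>; then \<open>b\<close> is an eigenvalue of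
  \<open>ad e\<close>, and once \<open>b = 0\<close>, \<open>a\<close> is one of \<open>ad Je\<close>, so both vanish.\<close>
lemma nilpotent_on_complex_line:
  assumes U: "subspace U" "\<And>y. y \<in> U \<Longrightarrow> J y \<in> U" "\<And>y. y \<in> U \<Longrightarrow> br e y \<in> U"
      "\<And>y. y \<in> U \<Longrightarrow> br (J e) y \<in> U"
    and M: "subspace M" "U \<subseteq> M" "\<And>y. y \<in> M \<Longrightarrow> J y \<in> M" "\<And>y. y \<in> M \<Longrightarrow> br e y \<in> M"
      "\<And>y. y \<in> M \<Longrightarrow> br (J e) y \<in> M"
    and line: "\<And>y. y \<in> M \<Longrightarrow> \<exists>s t. y - (s *\<^sub>R m + t *\<^sub>R J m) \<in> U"
    and y: "y \<in> M"
  shows "br e y \<in> U \<and> br (J e) y \<in> U"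
proof (cases "M \<subseteq> U")
  case True
  then show ?thesis using U(3,4) y by blast
next
  case False
  obtain N where N: "lower_central br N = {0}" using nilpotent by (auto simp: nilpotent_lie_def)
  let ?P = "\<lambda>k. M \<inter> lower_central br k \<subseteq> U"
  have "?P N" using N subspace_0[OF U(1)] by auto
  moreover have "\<not> ?P 0" using False by simp
  ultimately obtain k where k: "\<not> ?P k" "?P (Suc k)"
    using ex_least_nat_less[of ?P N] by blast
  then obtain x where x: "x \<in> M" "x \<in> lower_central br k" "x \<notin> U" by blast
  have Ax: "br e x \<in> U" "br (J e) x \<in> U"
    using k(2) M(4)[OF x(1)] M(5)[OF x(1)] br_lower_central[OF x(2)] by blast+
  have Jx: "J x \<in> M" "J x \<notin> U"
    using M(3)[OF x(1)] x(3) U(2)[of "J x"] subspace_neg[OF U(1), of "- x"] by auto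
  have line': "\<exists>s t. z - (s *\<^sub>R x + t *\<^sub>R J x) \<in> U" if "z \<in> M" for z
  proof -
    obtain a b where ab: "x - (a *\<^sub>R m + b *\<^sub>R J m) \<in> U" using line[OF x(1)] by blast
    obtain s t where st: "z - (s *\<^sub>R m + t *\<^sub>R J m) \<in> U" using line[OF \<open>z \<in> M\<close>] by blast
    \<comment> \<open>\<open>c + di\<close> is the complex quotient of \<open>s + ti\<close> by \<open>a + bi\<close>.\<close>
    define n where "n = a\<^sup>2 + b\<^sup>2"
    have n: "n \<noteq> 0"
      using ab x(3) by (auto simp: n_def sum_power2_eq_zero_iff)
    define c d where "c = (s * a + t * b) / n" and "d = (t * a - s * b) / n"
    have "(s * a + t * b) * a - (t * a - s * b) * b = s * n" "(s * a + t * b) * b + (t * a - s * b) * a = t * n"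
      by (simp_all add: n_def power2_eq_square algebra_simps)
    then have c: "c * a - d * b = s" "c * b + d * a = t"
      using n by (simp_all add: c_def d_def diff_divide_distrib[symmetric] add_divide_distrib[symmetric])
    have "(z - (s *\<^sub>R m + t *\<^sub>R J m)) - (c *\<^sub>R (x - (a *\<^sub>R m + b *\<^sub>R J m)) + d *\<^sub>R J (x - (a *\<^sub>R m + b *\<^sub>R J m))) \<in> U"
      by (rule subspace_diff[OF U(1) st subspace_add[OF U(1) subspace_scale[OF U(1) ab]
        subspace_scale[OF U(1) U(2)[OF ab]]]])
    moreover have "(z - (s *\<^sub>R m + t *\<^sub>R J m)) - (c *\<^sub>R (x - (a *\<^sub>R m + b *\<^sub>R J m)) + d *\<^sub>R J (x - (a *\<^sub>R m + b *\<^sub>R J m)))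
        = z - (c *\<^sub>R x + d *\<^sub>R J x)"
      unfolding c[symmetric] by (simp add: algebra_simps)
    ultimately show ?thesis by (metis (no_types))
  qed
  obtain a b where ab: "br e (J x) - (a *\<^sub>R x + b *\<^sub>R J x) \<in> U" using line'[OF M(4)[OF Jx(1)]] by blast
  have "br (J e) (J x) = br e x + J (br (J e) x) + J (br e (J x))"
    using integrable[of e x] by (simp add: algebra_simps)
  then have "br (J e) (J x) - (a *\<^sub>R J x - b *\<^sub>R x)
      = br e x + J (br (J e) x) + J (br e (J x) - (a *\<^sub>R x + b *\<^sub>R J x))"
    by (simp add: algebra_simps)
  also have "\<dots> \<in> U" by (rule subspace_add[OF U(1) subspace_add[OF U(1) Ax(1) U(2)[OF Ax(2)]] U(2)[OF ab]])
  finally have BJ: "br (J e) (J x) - (a *\<^sub>R J x - b *\<^sub>R x) \<in> U" .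
  have b0: "b = 0"
  proof (rule ccontr)
    assume b: "b \<noteq> 0"
    define z where "z = a *\<^sub>R x + b *\<^sub>R J x"
    have "br e z - b *\<^sub>R z = a *\<^sub>R br e x + b *\<^sub>R (br e (J x) - (a *\<^sub>R x + b *\<^sub>R J x))"
      by (simp add: z_def algebra_simps)
    also have "\<dots> \<in> U" by (rule subspace_add[OF U(1) subspace_scale[OF U(1) Ax(1)] subspace_scale[OF U(1) ab]])
    finally have "z \<in> U" using no_eigenvalue[OF U(1,3)] b by blast
    have zz: "J z \<in> U" using U(2) \<open>z \<in> U\<close> by blast
    have "(1/(a\<^sup>2+b\<^sup>2)) *\<^sub>R (a *\<^sub>R z - b *\<^sub>R J z) \<in> U"
      by (rule subspace_scale[OF U(1) subspace_diff[OF U(1) subspace_scale[OF U(1) \<open>z \<in> U\<close>]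
        subspace_scale[OF U(1) zz]]])
    moreover have n: "a\<^sup>2 + b\<^sup>2 \<noteq> 0" using b by (simp add: sum_power2_eq_zero_iff)
    have eq: "a *\<^sub>R z - b *\<^sub>R J z = (a\<^sup>2 + b\<^sup>2) *\<^sub>R x"
      by (simp add: z_def power2_eq_square algebra_simps)
    then have "(1/(a\<^sup>2+b\<^sup>2)) *\<^sub>R (a *\<^sub>R z - b *\<^sub>R J z) = x"
      unfolding eq by (simp only: scaleR_scaleR times_divide_eq_left mult_1 divide_self[OF n] scaleR_one)
    ultimately show False using x by simp
  qed
  have a0: "a = 0"
  proof (rule ccontr)
    assume "a \<noteq> 0"
    moreover have "br (J e) (J x) - a *\<^sub>R J x \<in> U" using BJ by (simp add: b0)
    ultimately have "J x \<in> U" using no_eigenvalue[OF U(1,4), of "J x" a] by metis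
    with Jx show False by simp
  qed
  obtain s t where st: "y - (s *\<^sub>R x + t *\<^sub>R J x) \<in> U" using line'[OF y] by blast
  have *: "br f y \<in> U" if "br f x \<in> U" "br f (J x) \<in> U" "\<And>z. z \<in> U \<Longrightarrow> br f z \<in> U" for f
  proof -
    have "br f (y - (s *\<^sub>R x + t *\<^sub>R J x)) + (s *\<^sub>R br f x + t *\<^sub>R br f (J x)) \<in> U"
      by (rule subspace_add[OF U(1) that(3)[OF st] subspace_add[OF U(1) subspace_scale[OF U(1) that(1)]
        subspace_scale[OF U(1) that(2)]]])
    moreover have "br f (y - (s *\<^sub>R x + t *\<^sub>R J x)) + (s *\<^sub>R br f x + t *\<^sub>R br f (J x)) = br f y" by simp
    ultimately show ?thesis by metis
  qed
  have "br e (J x) \<in> U" "br (J e) (J x) \<in> U" using ab BJ by (simp_all add: a0 b0)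
  then show ?thesis using * [OF Ax(1) _ U(3)] * [OF Ax(2) _ U(4)] by blast
qed

definition complex_hull :: "'a set \<Rightarrow> 'a set" where
  "complex_hull D = {a + J b | a b. a \<in> D \<and> b \<in> D}"

lemma subspace_complex_hull:
  assumes "subspace D" shows "subspace (complex_hull D)"
  unfolding subspace_def
proof (intro conjI ballI allI)
  show "0 \<in> complex_hull D" using subspace_0[OF assms] by (force simp: complex_hull_def)
next
  fix x y assume "x \<in> complex_hull D" "y \<in> complex_hull D"
  then obtain a b a' b' where "x = a + J b" "y = a' + J b'" "a \<in> D" "b \<in> D" "a' \<in> D" "b' \<in> D"
    by (auto simp: complex_hull_def)
  then have "x + y = (a + a') + J (b + b')" "a + a' \<in> D" "b + b' \<in> D"
    using subspace_add[OF assms] by (auto simp: algebra_simps)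
  then show "x + y \<in> complex_hull D" unfolding complex_hull_def by blast
next
  fix c x assume "x \<in> complex_hull D"
  then obtain a b where "x = a + J b" "a \<in> D" "b \<in> D" by (auto simp: complex_hull_def)
  then have "c *\<^sub>R x = c *\<^sub>R a + J (c *\<^sub>R b)" "c *\<^sub>R a \<in> D" "c *\<^sub>R b \<in> D"
    using subspace_scale[OF assms] by (auto simp: algebra_simps)
  then show "c *\<^sub>R x \<in> complex_hull D" unfolding complex_hull_def by blast
qed

lemma complex_hull_base:
  assumes "subspace D" "a \<in> D" shows "a \<in> complex_hull D" "J a \<in> complex_hull D"
  using assms(2) subspace_0[OF assms(1)] unfolding complex_hull_def by force+

lemma J_complex_hull:
  assumes "subspace D" "x \<in> complex_hull D" shows "J x \<in> complex_hull D"
proof -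
  obtain a b where "x = a + J b" "a \<in> D" "b \<in> D" using assms(2) unfolding complex_hull_def by blast
  then show ?thesis
    using subspace_diff[OF subspace_complex_hull complex_hull_base(2) complex_hull_base(1), of D a b]
      assms(1) by simp
qed

text \<open>With \<open>D\<close> the derived algebra of \<open>V\<close>, the point is \<open>D + JD \<noteq> V\<close>; any \<open>e\<close> orthogonal to \<open>D + JD\<close> then
  works. If \<open>D + JD = V\<close>, then by induction \<open>V = C + JC\<close> for the intersection \<open>C\<close> of \<open>V\<close> with every term
  of the lower central series, because every bracket of elements of \<open>C + JC\<close> lies in \<open>C' + JC'\<close> for the next
  term \<open>C'\<close>. As the series reaches zero, so does \<open>V\<close>.\<close>
lemma closed_10_form:
  assumes V: "subspace V" "\<And>x. x \<in> V \<Longrightarrow> J x \<in> V" "\<And>x y. x \<in> V \<Longrightarrow> y \<in> V \<Longrightarrow> br x y \<in> V"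
    and "V \<noteq> {0}"
  obtains e where "e \<in> V" "g e e = 1"
    "\<And>x y. x \<in> V \<Longrightarrow> y \<in> V \<Longrightarrow> g (br x y) e = 0 \<and> g (br x y) (J e) = 0"
proof -
  define D where "D = span {br x y | x y. x \<in> V \<and> y \<in> V}"
  let ?S = "complex_hull D"
  have "{br x y | x y. x \<in> V \<and> y \<in> V} \<subseteq> V" using V(3) by blast
  then have D: "subspace D" "D \<subseteq> V" unfolding D_def by (simp, rule span_minimal[OF _ V(1)])
  have inD: "br x y \<in> D" if "x \<in> V" "y \<in> V" for x y
    unfolding D_def using that by (auto intro!: span_base)
  have SV: "?S \<subseteq> V" using D V by (auto simp: complex_hull_def intro!: subspace_add)
  have "?S \<noteq> V"
  proof
    assume eq: "?S = V"
    obtain N where N: "lower_central br N = {0}" using nilpotent by (auto simp: nilpotent_lie_def)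
    have step: "V \<subseteq> complex_hull (V \<inter> lower_central br k)" for k
    proof (induction k)
      case 0
      then show ?case using complex_hull_base[OF V(1)] by auto
    next
      case (Suc k)
      let ?C = "V \<inter> lower_central br (Suc k)"
      have C: "subspace ?C" by (intro subspace_inter V subspace_lower_central)
      note E = subspace_complex_hull[OF C] and CE = complex_hull_base[OF C]
      have "br x y \<in> complex_hull ?C" if xy: "x \<in> V" "y \<in> V" for x y
      proof -
        obtain a b where x: "a \<in> V" "a \<in> lower_central br k" "b \<in> V" "b \<in> lower_central br k" "x = a + J b"
          using Suc.IH xy(1) unfolding complex_hull_def by blast
        obtain c d where y: "c \<in> V" "c \<in> lower_central br k" "d \<in> V" "d \<in> lower_central br k" "y = c + J d"
          using Suc.IH xy(2) unfolding complex_hull_def by blast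
        have in_C: "br p q \<in> ?C" "br q p \<in> ?C" if "p \<in> V" "q \<in> V" "q \<in> lower_central br k" for p q
          using that V(3) br_lower_central[of q k p] br_lower_central_left[of q k p] by auto
        \<comment> \<open>Integrability trades the one bracket with both entries outside the lower central series.\<close>
        have JJ: "br (J b) (J d) = br b d + J (br (J b) d) + J (br b (J d))"
          using integrable[of b d] by (simp add: algebra_simps)
        have "br x y = br a c + br a (J d) + br (J b) c + br (J b) (J d)"
          by (simp add: x y algebra_simps)
        also have "\<dots> \<in> complex_hull ?C" unfolding JJ
          by (intro subspace_add[OF E] CE in_C V x y)
        finally show ?thesis .
      qed
      then have "D \<subseteq> complex_hull ?C" unfolding D_def by (intro span_minimal E) auto
      then have "?S \<subseteq> complex_hull ?C"
        using J_complex_hull[OF C] subspace_add[OF E] unfolding complex_hull_def[of D] by blast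
      then show ?case using eq by blast
    qed
    have "V \<subseteq> {0}" using step[of N] N by (auto simp: complex_hull_def)
    with \<open>V \<noteq> {0}\<close> subspace_0[OF V(1)] show False by blast
  qed
  then obtain v where v: "v \<in> V" "v \<notin> ?S" using SV by blast
  obtain r where r: "r \<noteq> 0" "v - r \<in> ?S" "\<And>s. s \<in> ?S \<Longrightarrow> g s r = 0"
    using orthogonal_residue[OF subspace_complex_hull[OF D(1)] v(2)] by blast
  have rV: "r \<in> V" using subspace_diff[OF V(1) v(1), of "v - r"] r(2) SV by auto
  obtain t where t: "t > 0" "g (t *\<^sub>R r) (t *\<^sub>R r) = 1" using normalize[OF r(1)] by blast
  show ?thesis
  proof (rule that[of "t *\<^sub>R r"])
    fix x y assume xy: "x \<in> V" "y \<in> V"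
    have "br x y \<in> ?S" "J (br x y) \<in> ?S"
      using complex_hull_base[OF D(1) inD[OF xy]] by blast+
    then show "g (br x y) (t *\<^sub>R r) = 0 \<and> g (br x y) (J (t *\<^sub>R r)) = 0"
      using r(3)[of "br x y"] r(3)[of "J (br x y)"] by (simp add: g_J_left)
  qed (use t rV V in \<open>auto intro: subspace_scale\<close>)
qed

end

section \<open>The torsion equation with an abelian complex hyperplane\<close>

context hermitian_nilpotent begin

lemma torsion:
  "bismut_torsion br J g x y z = g (br (J x) (J y)) z + g (br (J y) (J z)) x + g (br (J z) (J x)) y"
  by (simp add: bismut_torsion_def d2_def fundamental_form_def br_swap[of "J z" "J x"])

definition perp :: "'a \<Rightarrow> 'a set" where
  "perp e = {x. g x e = 0 \<and> g x (J e) = 0}"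

definition h8_bracket :: "'a \<Rightarrow> 'a \<Rightarrow> bool" where
  "h8_bracket e u \<longleftrightarrow> g e e = 1 \<and> g u e = 0 \<and> g u (J e) = 0 \<and>
     (\<forall>x y. br x y = (g x e * g y (J e) - g x (J e) * g y e) *\<^sub>R u)"

text \<open>The nonzero brackets are \<open>[e,Je] = u\<close>, \<open>[e,Jp] = w\<close>, \<open>[Je,Jp] = Jw\<close> and what follows from the
  component of \<open>u\<close> along \<open>Jp\<close>, which makes the algebra three-step.\<close>
definition h16_bracket :: "'a \<Rightarrow> 'a \<Rightarrow> 'a \<Rightarrow> 'a \<Rightarrow> bool" where
  "h16_bracket e p u w \<longleftrightarrow> g e e = 1 \<and> g p p = 1 \<and> g e p = 0 \<and> g e (J p) = 0 \<and>
     w \<noteq> 0 \<and> w \<in> perp e \<inter> perp p \<and> u \<in> perp e \<and> g u p = 0 \<and> g u (J p) \<noteq> 0 \<and>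
     (\<forall>x y. br x y = (g x e * g y (J e) - g x (J e) * g y e) *\<^sub>R u
        + (g x e * g y (J p) - g x (J p) * g y e) *\<^sub>R w
        + (g x (J e) * g y (J p) - g x (J p) * g y (J e)) *\<^sub>R J w)"

lemma perpD: "x \<in> perp e \<Longrightarrow> g x e = 0 \<and> g x (J e) = 0"
  by (simp add: perp_def)

lemma perpI: "g x e = 0 \<Longrightarrow> g x (J e) = 0 \<Longrightarrow> x \<in> perp e"
  by (simp add: perp_def)

lemma subspace_perp: "subspace (perp e)"
  by (simp add: perp_def subspace_def)

lemma J_perp: "x \<in> perp e \<Longrightarrow> J x \<in> perp e"
  by (simp add: perp_def g_J_left)

text \<open>Take the last nonzero term of the lower central series.\<close>
lemma central_bracket:
  assumes "\<not> abelian_lie br"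
  obtains x where "x \<noteq> 0" "\<And>y. br x y = 0" "x \<in> span {br a b | a b. True}"
proof -
  obtain N where N: "lower_central br N = {0}" using nilpotent by (auto simp: nilpotent_lie_def)
  let ?P = "\<lambda>k. lower_central br (Suc k) \<subseteq> {0}"
  have "?P N" using lower_central_decreasing[of N] N by blast
  moreover have "\<not> ?P 0"
  proof
    assume z: "?P 0"
    have "br x y = 0" for x y
      using br_lower_central[of y 0 x] z by auto
    with assms show False by (simp add: abelian_lie_def)
  qed
  ultimately obtain k where k: "\<not> ?P k" "?P (Suc k)"
    using ex_least_nat_less[of ?P N] by blast
  then obtain x where x: "x \<in> lower_central br (Suc k)" "x \<noteq> 0" by blast
  have "br x y = 0" for y using br_lower_central_left[OF x(1)] k(2) by blast
  moreover have "x \<in> span {br a b | a b. True}"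
  proof -
    have "{br a b | a b. b \<in> lower_central br k} \<subseteq> {br a b | a b. True}" by blast
    then show ?thesis using x(1) span_mono by (simp only: lower_central.simps(2)) blast
  qed
  ultimately show ?thesis using that x(2) by blast
qed

end

locale lcskt_nilpotent = hermitian_nilpotent br J g
  for br :: "'a::real_vector \<Rightarrow> 'a \<Rightarrow> 'a" and J g +
  fixes \<alpha> :: "'a \<Rightarrow> real"
  assumes linear_\<alpha>: "linear \<alpha>" and \<alpha>_nonzero: "\<alpha> \<noteq> (\<lambda>x. 0)"
    and \<alpha>_closed: "d1 br \<alpha> = (\<lambda>x y. 0)"
    and dH: "d3 br (bismut_torsion br J g) = wedge13 \<alpha> (bismut_torsion br J g)"
    and nonabelian: "\<not> abelian_lie br"
begin

abbreviation "H \<equiv> bismut_torsion br J g"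

lemmas \<alpha>_lin [simp] = linear_add [OF linear_\<alpha>] linear_diff [OF linear_\<alpha>]
  linear_neg [OF linear_\<alpha>] linear_scale [OF linear_\<alpha>, simplified] linear_0 [OF linear_\<alpha>]

lemma \<alpha>_br [simp]: "\<alpha> (br x y) = 0"
  using fun_cong[OF fun_cong[OF \<alpha>_closed]] by (simp add: d1_def)

lemma dH_at:
  "- H (br x y) z w + H (br x z) y w - H (br x w) y z
   - H (br y z) x w + H (br y w) x z - H (br z w) x y
   = \<alpha> x * H y z w - \<alpha> y * H x z w + \<alpha> z * H x y w - \<alpha> w * H x y z"
  using fun_cong[OF fun_cong[OF fun_cong[OF fun_cong[OF dH]]], of x y z w]
  by (simp add: d3_def wedge13_def)

lemma H_swap: "H y x z = - H x y z" "H x z y = - H x y z"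
  using br_swap[of "J x" "J y"] br_swap[of "J y" "J z"] br_swap[of "J z" "J x"]
  by (simp_all add: torsion)

end

locale abelian_ideal = lcskt_nilpotent br J g \<alpha>
  for br :: "'a::real_vector \<Rightarrow> 'a \<Rightarrow> 'a" and J g \<alpha> +
  fixes e :: 'a
  assumes e_unit: "g e e = 1"
    and br_perp: "br x y \<in> perp e"
    and perp_abelian: "x \<in> perp e \<Longrightarrow> y \<in> perp e \<Longrightarrow> br x y = 0"
begin

text \<open>The skew part of \<open>ad z \<circ> J\<close>, up to a factor 2, as a 2-form. For \<open>z = e\<close> and \<open>z = Je\<close> it carries all of
  \<open>H\<close> except the components with both entries \<open>e\<close> and \<open>Je\<close>.\<close>
definition skew_ad :: "'a \<Rightarrow> 'a \<Rightarrow> 'a \<Rightarrow> real" where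
  "skew_ad z y w = g (br z (J y)) w - g (br z (J w)) y"

lemma g_br_e [simp]: "g (br x y) e = 0" "g (br x y) (J e) = 0" "g e (br x y) = 0" "g (J e) (br x y) = 0"
  using perpD[OF br_perp[of x y]] g_sym by metis+

lemma H_perp:
  assumes "y \<in> perp e" "z \<in> perp e"
  shows "H e y z = skew_ad (J e) y z" "H (J e) y z = - skew_ad e y z"
    "w \<in> perp e \<Longrightarrow> H y z w = 0"
  using perp_abelian[OF J_perp J_perp, OF assms] perp_abelian[OF J_perp J_perp, OF assms(1), of w]
    perp_abelian[OF J_perp J_perp, OF assms(2), of w] perp_abelian[OF J_perp J_perp, of w y] assms
    br_swap[of "J z" "J e"] br_swap[of "J z" e]
  by (simp_all add: torsion skew_ad_def)

lemma H_e_Je: "H e (J e) y = g (br e (J e)) y"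
  using br_swap[of "J e" e] by (simp add: torsion)

text \<open>The components \<open>(Je,y,z,w)\<close> and \<open>(e,y,z,w)\<close> of \<open>dH = \<alpha> \<and> H\<close>: every term of \<open>dH\<close> has a
  bracket of two vectors of the abelian ideal or three entries in it, and is zero.\<close>
lemma wedge_skew_ad:
  assumes "y \<in> perp e" "z \<in> perp e" "w \<in> perp e"
  shows "\<alpha> y * skew_ad e z w - \<alpha> z * skew_ad e y w + \<alpha> w * skew_ad e y z = 0"
    and "\<alpha> y * skew_ad (J e) z w - \<alpha> z * skew_ad (J e) y w + \<alpha> w * skew_ad (J e) y z = 0"
proof -
  have 0: "br y z = 0" "br y w = 0" "br z w = 0" using assms perp_abelian by blast+
  have H0: "H 0 a b = 0" for a b by (simp add: torsion)
  note * = H_perp(3)[OF br_perp]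
  show "\<alpha> y * skew_ad (J e) z w - \<alpha> z * skew_ad (J e) y w + \<alpha> w * skew_ad (J e) y z = 0"
    using dH_at[of e y z w] by (simp add: assms H0 0 * H_perp)
  show "\<alpha> y * skew_ad e z w - \<alpha> z * skew_ad e y w + \<alpha> w * skew_ad e y z = 0"
    using dH_at[of "J e" y z w] by (simp add: assms H0 0 * H_perp)
qed

lemma dH_e_Je:
  assumes "y \<in> perp e" "z \<in> perp e"
  shows "skew_ad e (br e y) z - skew_ad e (br e z) y + skew_ad (J e) (br (J e) y) z - skew_ad (J e) (br (J e) z) y
    = - \<alpha> e * skew_ad e y z - \<alpha> (J e) * skew_ad (J e) y z + \<alpha> y * g (br e (J e)) z - \<alpha> z * g (br e (J e)) y"
proof -
  have 0: "br y z = 0" using assms perp_abelian by blast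
  have H0: "H 0 a b = 0" for a b by (simp add: torsion)
  have s: "H (br e y) (J e) z = - H (J e) (br e y) z" "H (br e z) (J e) y = - H (J e) (br e z) y"
    "H (br (J e) y) e z = - H e (br (J e) y) z" "H (br (J e) z) e y = - H e (br (J e) z) y"
    by (rule H_swap)+
  show ?thesis
    using dH_at[of e "J e" y z] by (simp add: 0 H0 s H_perp H_e_Je br_perp assms)
qed

text \<open>If \<open>T\<close> is the skew operator \<open>S - S\<^sup>t\<close> with \<open>S = ad z \<circ> J\<close>, the left side is
  \<open>- tr(T S)\<close>, which equals \<open>- tr(T\<^sup>2)/2\<close> because \<open>T\<close> only sees the skew part of \<open>S\<close>.\<close>
lemma skew_ad_trace:
  assumes F: "unitary_frame e p q"
  shows "skew_ad z (br z p) (J p) - skew_ad z (br z (J p)) p + skew_ad z (br z q) (J q) - skew_ad z (br z (J q)) q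
    = (skew_ad z p (J p))\<^sup>2 + (skew_ad z p q)\<^sup>2 + (skew_ad z p (J q))\<^sup>2 + (skew_ad z (J p) q)\<^sup>2 + (skew_ad z (J p) (J q))\<^sup>2
      + (skew_ad z q (J q))\<^sup>2"
proof -
  have ex: "br z f = g (br z f) p *\<^sub>R p + g (br z f) (J p) *\<^sub>R J p + g (br z f) q *\<^sub>R q
      + g (br z f) (J q) *\<^sub>R J q" for f
    using frame_expand[OF F, of "br z f"] by simp
  have A: "g (br z (J (br z f))) h = g (br z f) p * g (br z (J p)) h - g (br z f) (J p) * g (br z p) h
      + g (br z f) q * g (br z (J q)) h - g (br z f) (J q) * g (br z q) h" for f h
    by (subst ex[of f]) simp
  have B: "g (br z f) (br z f) = (g (br z f) p)\<^sup>2 + (g (br z f) (J p))\<^sup>2 + (g (br z f) q)\<^sup>2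
      + (g (br z f) (J q))\<^sup>2" for f
    by (subst (2) ex[of f]) (simp add: power2_eq_square)
  show ?thesis
    by (simp add: skew_ad_def A B power2_eq_square algebra_simps)
qed

lemma perp_expand:
  assumes "unitary_frame e x p" "y \<in> perp e"
  shows "y = g y x *\<^sub>R x + g y (J x) *\<^sub>R J x + g y p *\<^sub>R p + g y (J p) *\<^sub>R J p"
  using frame_expand[OF assms(1), of y] perpD[OF assms(2)] by simp

lemma frame_perp:
  assumes "unitary_frame e x p"
  shows "x \<in> perp e" "J x \<in> perp e" "p \<in> perp e" "J p \<in> perp e"
  using unitary_frame_g[OF assms] by (auto simp: perp_def)

text \<open>Adding the components \<open>(e,Je,x,Jx)\<close> and \<open>(e,Je,p,Jp)\<close> of \<open>dH = \<alpha> \<and> H\<close> gives the squares of all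
  entries of both forms on one side. The other side is a combination of the traces of
  \<open>ad e\<close> and \<open>ad Je\<close>, since \<open>\<alpha>\<close> vanishes on the ideal.\<close>
lemma skew_ad_vanishes:
  assumes F: "unitary_frame e x p" and \<alpha>0: "\<And>y. y \<in> perp e \<Longrightarrow> \<alpha> y = 0"
    and z: "z = e \<or> z = J e" and y: "y \<in> perp e" "y' \<in> perp e"
  shows "skew_ad z y y' = 0"
proof -
  note P = frame_perp[OF F]
  have tr: "g (br z x) x + g (br z (J x)) (J x) + g (br z p) p + g (br z (J p)) (J p) = 0" for z
    using trace_br[OF F, of z] by simp
  have t: "skew_ad z x (J x) + skew_ad z p (J p) = 0" for z
    using tr[of z] by (simp add: skew_ad_def)
  have s1: "skew_ad e (br e x) (J x) - skew_ad e (br e (J x)) x + skew_ad (J e) (br (J e) x) (J x) - skew_ad (J e) (br (J e) (J x)) x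
    = - \<alpha> e * skew_ad e x (J x) - \<alpha> (J e) * skew_ad (J e) x (J x)"
    using dH_e_Je[OF P(1,2)] \<alpha>0[OF P(1)] \<alpha>0[OF P(2)] by simp
  have s2: "skew_ad e (br e p) (J p) - skew_ad e (br e (J p)) p + skew_ad (J e) (br (J e) p) (J p) - skew_ad (J e) (br (J e) (J p)) p
    = - \<alpha> e * skew_ad e p (J p) - \<alpha> (J e) * skew_ad (J e) p (J p)"
    using dH_e_Je[OF P(3,4)] \<alpha>0[OF P(3)] \<alpha>0[OF P(4)] by simp
  have r: "- \<alpha> e * skew_ad e x (J x) - \<alpha> (J e) * skew_ad (J e) x (J x)
    + (- \<alpha> e * skew_ad e p (J p) - \<alpha> (J e) * skew_ad (J e) p (J p))
    = - \<alpha> e * (skew_ad e x (J x) + skew_ad e p (J p)) - \<alpha> (J e) * (skew_ad (J e) x (J x) + skew_ad (J e) p (J p))"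
    by (simp add: algebra_simps)
  define Q where "Q z = (skew_ad z x (J x))\<^sup>2 + (skew_ad z x p)\<^sup>2 + (skew_ad z x (J p))\<^sup>2 + (skew_ad z (J x) p)\<^sup>2
     + (skew_ad z (J x) (J p))\<^sup>2 + (skew_ad z p (J p))\<^sup>2" for z
  have "Q e + Q (J e) = 0"
    using s1 s2 r skew_ad_trace[OF F, of e] skew_ad_trace[OF F, of "J e"] by (simp add: t Q_def)
  moreover have nn: "Q z \<ge> 0" for z by (simp add: Q_def)
  ultimately have "Q e = 0" "Q (J e) = 0" using nn[of e] nn[of "J e"] by linarith+
  then have "Q z = 0" using z by auto
  then have *: "skew_ad z x (J x) = 0" "skew_ad z x p = 0" "skew_ad z x (J p) = 0" "skew_ad z (J x) p = 0"
     "skew_ad z (J x) (J p) = 0" "skew_ad z p (J p) = 0"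
    by (simp_all add: Q_def add_nonneg_eq_0_iff)
  have anti: "skew_ad z a b = - skew_ad z b a" for a b by (simp add: skew_ad_def)
  have lin: "skew_ad z (a + b) c = skew_ad z a c + skew_ad z b c" "skew_ad z (t *\<^sub>R a) c = t * skew_ad z a c"
    "skew_ad z c (a + b) = skew_ad z c a + skew_ad z c b" "skew_ad z c (t *\<^sub>R a) = t * skew_ad z c a" for a b c t
    by (simp_all add: skew_ad_def algebra_simps)
  have self: "skew_ad z a a = 0" for a by (simp add: skew_ad_def)
  show ?thesis
    by (subst perp_expand[OF F y(1)], subst perp_expand[OF F y(2)])
      (simp only: lin self * anti[of "J x" x] anti[of p x] anti[of "J p" x] anti[of p "J x"]
        anti[of "J p" "J x"] anti[of "J p" p], simp)
qed

lemma derived_algebra_perp: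
  assumes "x \<in> span {br a b | a b. True}"
  shows "\<alpha> x = 0" "x \<in> perp e"
proof -
  show "x \<in> perp e"
    using span_minimal[OF _ subspace_perp, of "{br a b | a b. True}" e] br_perp assms by blast
  have "subspace {x. \<alpha> x = 0}" by (simp add: subspace_def)
  moreover have "{br a b | a b. True} \<subseteq> {x. \<alpha> x = 0}" by auto
  ultimately show "\<alpha> x = 0" using span_minimal assms by blast
qed

text \<open>For central \<open>x\<close> in the derived algebra let \<open>y = [e,Jx]\<close>. Integrability gives \<open>[Je,Jx] = Jy\<close>, and
  \<open>ad e\<close> and \<open>ad Je\<close> commute on the abelian ideal; therefore
  \<open>skew_ad e y x + skew_ad (Je) (Jy) x = -2|y|\<^sup>2\<close>. Both terms vanish: if \<open>\<alpha>\<close> is zero on the ideal because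
  the forms do, and otherwise because \<open>\<alpha>\<close> wedges them to zero and kills \<open>x\<close>, \<open>y\<close> and \<open>Jy\<close>.\<close>
lemma complex_central_line:
  obtains x where "g x x = 1" "x \<in> perp e" "\<alpha> x = 0" "\<And>y. br x y = 0" "\<And>y. br (J x) y = 0"
proof -
  obtain x' where x': "x' \<noteq> 0" "\<And>y. br x' y = 0" "x' \<in> span {br a b | a b. True}"
    using central_bracket[OF nonabelian] by blast
  obtain t where t: "g (t *\<^sub>R x') (t *\<^sub>R x') = 1" using normalize[OF x'(1)] by blast
  define x where "x = t *\<^sub>R x'"
  have x1: "g x x = 1" unfolding x_def by (rule t)
  have xp: "x \<in> perp e" "\<alpha> x = 0"
    using derived_algebra_perp[OF x'(3)] subspace_scale[OF subspace_perp] by (auto simp: x_def)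
  have xc: "br x v = 0" "br v x = 0" for v
    using x'(2)[of v] br_swap[of x v] by (simp_all add: x_def)
  have Jxp: "J x \<in> perp e" by (rule J_perp[OF xp(1)])
  define y where "y = br e (J x)"
  have By: "br (J e) (J x) = J y"
    using integrable[of e x] by (simp add: xc y_def)
  have comm: "br e (J y) = br (J e) y"
    using jacobi[of e "J e" "J x"] perp_abelian[OF Jxp br_perp, of e "J e"]
      br_swap[of "J x" e] by (simp add: By y_def)
  have key: "skew_ad e y x + skew_ad (J e) (J y) x = - 2 * g y y"
    by (simp add: skew_ad_def y_def[symmetric] By comm)
  have yp: "y \<in> perp e" "J y \<in> perp e" "\<alpha> y = 0" "\<alpha> (J y) = 0"
    using br_perp[of e "J x"] br_perp[of "J e" "J x"] \<alpha>_br[of e "J x"] \<alpha>_br[of "J e" "J x"]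
    by (simp_all only: By y_def[symmetric])
  have "skew_ad e y x = 0 \<and> skew_ad (J e) (J y) x = 0"
  proof (cases "\<forall>k\<in>perp e. \<alpha> k = 0")
    case True
    have "g e x = 0" "g e (J x) = 0" using perpD[OF xp(1)] g_sym[of e x] g_J_left[of e x] g_sym[of "J e" x] by auto
    then obtain p where "unitary_frame e x p" using unitary_frame_complete[OF e_unit x1] by blast
    then show ?thesis using skew_ad_vanishes True yp xp by blast
  next
    case False
    then obtain k where k: "k \<in> perp e" "\<alpha> k \<noteq> 0" by blast
    show ?thesis
      using wedge_skew_ad(1)[OF k(1) yp(1) xp(1)] wedge_skew_ad(2)[OF k(1) yp(2) xp(1)] k yp xp by simp
  qed
  with key have y0: "y = 0" by simp
  have "br (J x) v = 0" for v
  proof -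
    define k where "k = v - (g v e *\<^sub>R e + g v (J e) *\<^sub>R J e)"
    have "k \<in> perp e" by (rule perpI) (simp_all add: k_def e_unit)
    then have "br (J x) k = 0" by (rule perp_abelian[OF Jxp])
    moreover have "br (J x) e = 0" "br (J x) (J e) = 0"
      using br_swap[of "J x" e] br_swap[of "J x" "J e"] By y0 by (simp_all add: y_def)
    ultimately show ?thesis by (simp add: k_def)
  qed
  then show ?thesis using that x1 xp xc by blast
qed

lemma bracket_expand:
  assumes F: "unitary_frame e x p" and x: "\<And>y. br x y = 0" "\<And>y. br (J x) y = 0"
  shows "br a b = (g a e * g b (J e) - g a (J e) * g b e) *\<^sub>R br e (J e)
    + (g a e * g b p - g a p * g b e) *\<^sub>R br e p
    + (g a e * g b (J p) - g a (J p) * g b e) *\<^sub>R br e (J p)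
    + (g a (J e) * g b p - g a p * g b (J e)) *\<^sub>R br (J e) p
    + (g a (J e) * g b (J p) - g a (J p) * g b (J e)) *\<^sub>R br (J e) (J p)"
proof -
  have 0: "br y x = 0" "br y (J x) = 0" for y
    using x br_swap[of x y] br_swap[of "J x" y] by simp_all
  have 1: "br p (J p) = 0" using frame_perp[OF F] perp_abelian by blast
  have sw: "br (J e) e = - br e (J e)" "br p e = - br e p" "br (J p) e = - br e (J p)"
    "br p (J e) = - br (J e) p" "br (J p) (J e) = - br (J e) (J p)" "br (J p) p = - br p (J p)"
    by (rule br_swap)+
  have "br a b = br (g a e *\<^sub>R e + g a (J e) *\<^sub>R J e + g a x *\<^sub>R x + g a (J x) *\<^sub>R J x
      + g a p *\<^sub>R p + g a (J p) *\<^sub>R J p) (g b e *\<^sub>R e + g b (J e) *\<^sub>R J e + g b x *\<^sub>R x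
      + g b (J x) *\<^sub>R J x + g b p *\<^sub>R p + g b (J p) *\<^sub>R J p)"
    by (rule arg_cong2[where f = br, OF frame_expand[OF F] frame_expand[OF F]])
  also have "\<dots> = (g a e * g b (J e)) *\<^sub>R br e (J e) - (g a (J e) * g b e) *\<^sub>R br e (J e)
    + ((g a e * g b p) *\<^sub>R br e p - (g a p * g b e) *\<^sub>R br e p)
    + ((g a e * g b (J p)) *\<^sub>R br e (J p) - (g a (J p) * g b e) *\<^sub>R br e (J p))
    + ((g a (J e) * g b p) *\<^sub>R br (J e) p - (g a p * g b (J e)) *\<^sub>R br (J e) p)
    + ((g a (J e) * g b (J p)) *\<^sub>R br (J e) (J p) - (g a (J p) * g b (J e)) *\<^sub>R br (J e) (J p))"
    by (simp add: 0 1 x sw) (simp add: algebra_simps)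
  finally show ?thesis by (simp only: scaleR_diff_left)
qed

lemma h8_if_trivial_action:
  assumes F: "unitary_frame e x p" and x: "\<And>y. br x y = 0" "\<And>y. br (J x) y = 0"
    and "br e p = 0" "br e (J p) = 0" "br (J e) p = 0" "br (J e) (J p) = 0"
  shows "h8_bracket e (br e (J e))"
proof -
  have *: "br a b = (g a e * g b (J e) - g a (J e) * g b e) *\<^sub>R br e (J e)" for a b
    using bracket_expand[OF F x, of a b] by (simp only: assms(4-7) scaleR_zero_right add_0_right)
  show ?thesis unfolding h8_bracket_def by (intro conjI allI *) (simp_all add: e_unit)
qed

text \<open>With \<open>L\<close> the central complex line, \<open>ad e\<close> and \<open>ad Je\<close> map the ideal into \<open>L\<close>, and \<open>p\<close> spans the rest
  of the ideal over \<open>\<complex>\<close>. Rotating \<open>p\<close> achieves \<open>\<alpha>(Jp) = 0\<close>. If \<open>\<alpha>\<close> vanishes on the ideal, so do the two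
  forms; if \<open>\<alpha>(Jx) \<noteq> 0\<close>, wedging with \<open>\<alpha>\<close> and \<open>\<alpha>([\<cdot>,\<cdot>]) = 0\<close> remove the components along \<open>x\<close> and \<open>Jx\<close>;
  in both cases the action on the ideal is zero. Otherwise \<open>p\<close> is the only one of \<open>x, Jx, p, Jp\<close>
  on which \<open>\<alpha>\<close> is nonzero, and wedging kills
  \<open>[e,p]\<close> and \<open>[Je,p]\<close>.\<close>
lemma bracket_normal_form_if_perp_abelian:
  "(\<exists>e u. h8_bracket e u) \<or> (\<exists>e p u w. h16_bracket e p u w)"
proof -
  obtain x where x: "g x x = 1" "x \<in> perp e" "\<alpha> x = 0" "\<And>y. br x y = 0" "\<And>y. br (J x) y = 0"
    using complex_central_line by blast
  have xc: "br y x = 0" "br y (J x) = 0" for y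
    using x(4,5) br_swap[of x y] br_swap[of "J x" y] by simp_all
  have ex: "g e x = 0" "g e (J x) = 0"
    using perpD[OF x(2)] g_sym[of e x] g_J_left[of e x] g_sym[of "J e" x] by auto
  obtain p\<^sub>0 where F0: "unitary_frame e x p\<^sub>0"
    using unitary_frame_complete[OF e_unit x(1) ex] by blast
  \<comment> \<open>A rotation in the complex line of \<open>p\<^sub>0\<close> moves all of \<open>\<alpha>\<close> onto \<open>p\<close>.\<close>
  obtain p where F: "unitary_frame e x p" and Jp: "\<alpha> (J p) = 0"
  proof (cases "\<alpha> p\<^sub>0 = 0 \<and> \<alpha> (J p\<^sub>0) = 0")
    case True
    then show ?thesis using that F0 by blast
  next
    case False
    define n where "n = sqrt ((\<alpha> p\<^sub>0)\<^sup>2 + (\<alpha> (J p\<^sub>0))\<^sup>2)"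
    have n: "n\<^sup>2 = (\<alpha> p\<^sub>0)\<^sup>2 + (\<alpha> (J p\<^sub>0))\<^sup>2" "n \<noteq> 0"
      using False by (simp_all add: n_def sum_power2_eq_zero_iff)
    define p where "p = (\<alpha> p\<^sub>0 / n) *\<^sub>R p\<^sub>0 + (\<alpha> (J p\<^sub>0) / n) *\<^sub>R J p\<^sub>0"
    have "g p p = ((\<alpha> p\<^sub>0)\<^sup>2 + (\<alpha> (J p\<^sub>0))\<^sup>2) / n\<^sup>2"
      using unitary_frame_g[OF F0] by (simp add: p_def power2_eq_square add_divide_distrib)
    then have "g p p = 1" using n by (metis divide_self power_not_zero)
    then have "unitary_frame e x p"
      using F0 unitary_frame_g[OF F0] by (simp add: unitary_frame_def p_def)
    moreover have "\<alpha> (J p) = 0" by (simp add: p_def)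
    ultimately show ?thesis by (rule that)
  qed
  note P = frame_perp[OF F] and G = unitary_frame_g[OF F]
  define L where "L = perp e \<inter> perp p"
  have L: "y = g y x *\<^sub>R x + g y (J x) *\<^sub>R J x" if "y \<in> L" for y
    using perp_expand[OF F, of y] that perpD[of y p] by (simp add: L_def)
  have Lc: "br z y = 0" if "y \<in> L" for y z
    by (subst L[OF that]) (simp add: xc)
  have eng: "br e y \<in> L \<and> br (J e) y \<in> L" if "y \<in> perp e" for y
  proof (rule nilpotent_on_complex_line[where M = "perp e" and m = p])
    show sL: "subspace L" unfolding L_def by (intro subspace_inter subspace_perp)
    show "J y \<in> L" if "y \<in> L" for y using that J_perp by (auto simp: L_def)
    show "br e y \<in> L" if "y \<in> L" for y using Lc[OF that] subspace_0[OF sL] by simp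
    show "br (J e) y \<in> L" if "y \<in> L" for y using Lc[OF that] subspace_0[OF sL] by simp
    show "\<exists>s t. y - (s *\<^sub>R p + t *\<^sub>R J p) \<in> L" if y: "y \<in> perp e" for y
    proof (intro exI)
      show "y - (g y p *\<^sub>R p + g y (J p) *\<^sub>R J p) \<in> L"
        unfolding L_def using perpD[OF y] G by (auto intro!: perpI)
    qed
  qed (use that J_perp br_perp subspace_perp in \<open>auto simp: L_def\<close>)
  have in_L0: "y = 0" if "y \<in> L" "g y x = 0" "g y (J x) = 0" for y
    using L[OF that(1)] that by simp
  have flat: "br z y = 0" if z: "z = e \<or> z = J e" and y: "y \<in> perp e"
      and skew_ad: "skew_ad z (J y) x = 0" "skew_ad z (J y) (J x) = 0" for z y
  proof (rule in_L0)
    show "br z y \<in> L" using eng[OF y] z by auto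
  qed (use skew_ad in \<open>simp_all add: skew_ad_def xc\<close>)
  have h8: "\<exists>e u. h8_bracket e u" if "\<And>z y. z = e \<or> z = J e \<Longrightarrow> y \<in> perp e \<Longrightarrow> br z y = 0"
    using h8_if_trivial_action[OF F x(4,5)] that P by blast
  consider "\<forall>y\<in>perp e. \<alpha> y = 0" | "\<alpha> (J x) \<noteq> 0" | "\<alpha> (J x) = 0" "\<alpha> p \<noteq> 0"
  proof (cases "\<alpha> (J x) = 0 \<and> \<alpha> p = 0")
    case True
    have "\<alpha> y = 0" if "y \<in> perp e" for y
      by (subst perp_expand[OF F that]) (simp add: True Jp x)
    then show ?thesis using that(1) by blast
  qed (use that in blast)
  then show ?thesis
  proof cases
    case 1
    have "br z y = 0" if "z = e \<or> z = J e" "y \<in> perp e" for z y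
      using flat[OF that] skew_ad_vanishes[OF F _ that(1) J_perp[OF that(2)] P(1)]
        skew_ad_vanishes[OF F _ that(1) J_perp[OF that(2)] P(2)] 1 by blast
    then show ?thesis using h8 by blast
  next
    case 2
    have "br z y = 0" if z: "z = e \<or> z = J e" and y: "y \<in> perp e" for z y
    proof -
      have "\<alpha> (J x) * skew_ad z x (J y) - \<alpha> x * skew_ad z (J x) (J y) + \<alpha> (J y) * skew_ad z (J x) x = 0"
        using wedge_skew_ad[OF P(2,1) J_perp[OF y]] z by auto
      then have "skew_ad z x (J y) = 0" using 2 x(3) by (simp add: skew_ad_def xc)
      then have gx: "g (br z y) x = 0" by (simp add: skew_ad_def xc)
      have "br z y \<in> L" using eng[OF y] z by auto
      note e = L[OF this]
      have "\<alpha> (br z y) = g (br z y) (J x) * \<alpha> (J x)" by (subst e) (simp add: x(3))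
      then have "g (br z y) (J x) = 0" using 2 by simp
      then show ?thesis using e gx by simp
    qed
    then show ?thesis using h8 by blast
  next
    case 3
    define w where "w = br e (J p)"
    have zp: "br z p = 0" if z: "z = e \<or> z = J e" for z
    proof (rule flat[OF z P(3)])
      show "skew_ad z (J p) x = 0" "skew_ad z (J p) (J x) = 0"
        using wedge_skew_ad[OF P(3,4,1)] wedge_skew_ad[OF P(3,4,2)] z 3 Jp x(3) by auto
    qed
    then have p0: "br e p = 0" "br (J e) p = 0" by auto
    have Jw: "br (J e) (J p) = J w" using integrable[of e p] by (simp add: p0 w_def)
    have wL: "w \<in> L" using eng[OF P(4)] by (simp add: w_def)
    then have wp: "g w e = 0" "g w (J e) = 0" "g w p = 0" "g w (J p) = 0" "br z w = 0" "br z (J w) = 0" for z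
      using perpD Lc[OF wL] Lc[of "J w"] J_perp by (auto simp: L_def)
    have skew0: "skew_ad z 0 y = 0" for z y by (simp add: skew_ad_def)
    \<comment> \<open>The component \<open>(e,Je,p,Jp)\<close> of the torsion equation.\<close>
    have "2 * g w w = \<alpha> p * g (br e (J e)) (J p)"
      using dH_e_Je[OF P(3,4)] wp g_J_left[of w p]
      by (simp add: p0 Jp skew0 Jw w_def[symmetric]) (simp add: skew_ad_def wp Jw w_def[symmetric] p0)
    moreover have up: "g (br e (J e)) p = 0"
    proof -
      have "\<alpha> (br e (J e)) = g (br e (J e)) p * \<alpha> p"
        by (subst perp_expand[OF F br_perp]) (simp add: x(3) 3(1) Jp)
      then show ?thesis using 3(2) by simp
    qed
    ultimately have c: "w \<noteq> 0 \<Longrightarrow> g (br e (J e)) (J p) \<noteq> 0" by auto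
    show ?thesis
    proof (cases "w = 0")
      case True
      then have "h8_bracket e (br e (J e))"
        using h8_if_trivial_action[OF F x(4,5)] p0 Jw by (simp add: w_def)
      then show ?thesis by blast
    next
      case False
      have *: "br a b = (g a e * g b (J e) - g a (J e) * g b e) *\<^sub>R br e (J e)
          + (g a e * g b (J p) - g a (J p) * g b e) *\<^sub>R w
          + (g a (J e) * g b (J p) - g a (J p) * g b (J e)) *\<^sub>R J w" for a b
        using bracket_expand[OF F x(4,5), of a b]
        by (simp only: p0 Jw w_def[symmetric] scaleR_zero_right add_0_right)
      have "w \<in> perp e \<inter> perp p" using wL by (simp add: L_def)
      then have "h16_bracket e p (br e (J e)) w"
        unfolding h16_bracket_def by (intro conjI allI * False c[OF False] up br_perp G) auto
      then show ?thesis by blast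
    qed
  qed
qed

end

section \<open>Reduction to an abelian complex hyperplane\<close>

context lcskt_nilpotent begin

text \<open>With an entry \<open>l\<close> in \<open>L\<close>, \<open>dH\<close> vanishes and \<open>H(l,y,z) = g([Jy,Jz],l)\<close>; so \<open>\<alpha>\<close> wedges the \<open>L\<close>-valued
  2-form \<open>[J\<cdot>,J\<cdot>]\<close> to zero, and contraction with the vector \<open>a\<close> dual to \<open>\<alpha>\<close> shows that the bracket is
  decomposable with one factor \<open>g(e,\<cdot>)\<close>, \<open>e = Ja\<close>. For \<open>n\<close> orthogonal to \<open>e\<close> and \<open>Je\<close>, the component
  \<open>(e,Je,n,Jn)\<close> of \<open>dH\<close> is \<open>2|[e,n]|\<^sup>2\<close>, whereas that of \<open>\<alpha> \<and> H\<close> is zero.\<close>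
lemma derived_in_central_line:
  assumes L: "subspace L" "\<And>y. y \<in> L \<Longrightarrow> J y \<in> L" "\<And>y z. y \<in> L \<Longrightarrow> br z y = 0"
    and brL: "\<And>x y. br x y \<in> L"
    and \<alpha>L: "\<And>y. y \<in> L \<Longrightarrow> \<alpha> y = 0"
    and a: "g a a = 1" "c \<noteq> 0" "\<And>z. \<alpha> z = c * g a z"
  shows "h8_bracket (J a) (br (J a) (J (J a)))"
proof -
  define e where "e = J a"
  have Ja: "J e = - a" "J (- a) = - e" by (simp_all add: e_def)
  have Lc: "br y z = 0" if "y \<in> L" for y z using L(3)[OF that, of z] br_swap[of z y] by simp
  have HL: "H l y z = g (br (J y) (J z)) l" if "l \<in> L" for l y z
    using Lc[OF L(2)[OF that]] L(3)[OF L(2)[OF that]] by (simp add: torsion)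
  have HLL: "H l y z = 0" if "l \<in> L" "z \<in> L" for l y z
    using HL[OF that(1)] L(3)[OF L(2)[OF that(2)]] by simp
  have HLL': "H l z y = 0" if "l \<in> L" "z \<in> L" for l y z
    using HL[OF that(1)] Lc[OF L(2)[OF that(2)]] by simp
  have H0: "H 0 y z = 0" for y z by (simp add: torsion)
  have \<alpha>a: "\<alpha> a = c" using a by simp
  have wedge: "br z w = g e z *\<^sub>R br e w - g e w *\<^sub>R br e z" for z w
  proof -
    have *: "br (J z) (J w) = g a z *\<^sub>R br e (J w) - g a w *\<^sub>R br e (J z)" for z w
    proof -
      define D where "D = br (J z) (J w) - (g a z *\<^sub>R br e (J w) - g a w *\<^sub>R br e (J z))"
      have DL: "D \<in> L" unfolding D_def
        by (intro subspace_diff subspace_scale L(1) brL)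
      have "c * H D z w - \<alpha> z * H D a w + \<alpha> w * H D a z = 0"
        using dH_at[of D a z w] \<alpha>L[OF DL] Lc[OF DL] H0
          HLL[OF brL DL] HLL'[OF brL DL] by (simp add: \<alpha>a)
      \<comment> \<open>As all brackets lie in \<open>L\<close>, testing against \<open>D\<close> itself suffices.\<close>
      then have 0: "c * (g (br (J z) (J w)) D - (g a z * g (br e (J w)) D - g a w * g (br e (J z)) D)) = 0"
        unfolding HL[OF DL] a(3) e_def[symmetric] by (simp add: algebra_simps)
      have "g D D = g (br (J z) (J w) - (g a z *\<^sub>R br e (J w) - g a w *\<^sub>R br e (J z))) D"
        by (rule arg_cong[where f = "\<lambda>x. g x D", OF D_def])
      with 0 a(2) have "D = 0" by simp
      then show ?thesis unfolding D_def by simp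
    qed
    have "br z w = br (J (- J z)) (J (- J w))" by simp
    also have "\<dots> = g a (- J z) *\<^sub>R br e (J (- J w)) - g a (- J w) *\<^sub>R br e (J (- J z))" by (rule *)
    also have "\<dots> = g e z *\<^sub>R br e w - g e w *\<^sub>R br e z" by (simp add: e_def g_J_left)
    finally show ?thesis .
  qed
  have e1: "g e e = 1" using a(1) by (simp add: e_def)
  have eL: "g l e = 0" "g l (J e) = 0" if "l \<in> L" for l
    using \<alpha>L[OF that] \<alpha>L[OF L(2)[OF that]] a(2,3) g_sym[of l a] g_sym[of l "J a"] g_J_left[of a l]
    by (simp_all add: e_def)
  have flat: "br e n = 0" if n: "g n e = 0" "g n (J e) = 0" for n
  proof -
    have en: "g e n = 0" "g e (J n) = 0" using n g_sym[of e n] g_J_left[of e n] g_sym[of "J e" n] by auto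
    have Jen: "br (J e) n = 0" "br (J e) (J n) = 0" "br n (J n) = 0" "br (J n) n = 0"
      using wedge[of "J e" n] wedge[of "J e" "J n"] wedge[of n "J n"] wedge[of "J n" n] en by simp_all
    have "br e (J n) = J (br e n)"
      using integrable[of e n] Jen J_J[of "br e (J n)"] by (metis J_J J_lin(3,5) add_0 diff_0 minus_minus)
    note * = this
    have ae: "\<alpha> e = 0" "\<alpha> n = 0" "\<alpha> (J n) = 0"
      using n en g_sym[of a n] by (simp_all add: a(3) e_def g_J_left)
    have He: "H e n (J n) = 0"
      using brL[of "J n" n] eL by (simp add: torsion Jen br_swap[of n "J e"])
    have "H (br e (J e)) n (J n) = 0" "H (br e n) (J e) (J n) = g (br e n) (br e n)"
      "H (J (br e n)) (J e) n = - g (br e n) (br e n)"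
      unfolding HL[OF brL] HL[OF L(2)[OF brL]] by (simp_all add: Jen *)
    then have "2 * g (br e n) (br e n) = 0"
      using dH_at[of e "J e" n "J n"] by (simp add: Jen * ae He H0)
    then show ?thesis by simp
  qed
  have "br x y = (g x e * g y (J e) - g x (J e) * g y e) *\<^sub>R br e (J e)" for x y
  proof -
    have *: "br e z = g z (J e) *\<^sub>R br e (J e)" for z
    proof -
      have "br e (z - (g z e *\<^sub>R e + g z (J e) *\<^sub>R J e)) = 0"
        by (rule flat) (simp_all add: e1)
      then show ?thesis by simp
    qed
    have "br x y = g e x *\<^sub>R (g y (J e) *\<^sub>R br e (J e)) - g e y *\<^sub>R (g x (J e) *\<^sub>R br e (J e))"
      by (simp only: wedge[of x y] *[symmetric])
    then show ?thesis by (simp add: g_sym[of e] algebra_simps)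
  qed
  note formula = this
  show ?thesis
    unfolding h8_bracket_def e_def[symmetric] by (intro conjI allI formula e1 eL brL)
qed

text \<open>If the ideal \<open>K\<close> orthogonal to \<open>e, Je\<close> is not abelian, a closed \<open>(1,0)\<close>-form of \<open>K\<close> gives
  \<open>e'\<close> and a complex line \<open>L\<close> that is the centre of \<open>K\<close>, with \<open>[K,K]\<close> spanned by
  \<open>v = [e',Je'] \<noteq> 0\<close>. Being the centre of an ideal, \<open>L\<close> is invariant under \<open>ad e\<close> and \<open>ad Je\<close>, hence killed
  by them; so \<open>L\<close> is central, and it absorbs \<open>[e,K]\<close>, \<open>[Je,K]\<close> and, by the Jacobi identity, \<open>[e,Je]\<close>. The
  component \<open>(v,Jv,e',Je')\<close> reads \<open>\<alpha>(Jv)|v|\<^sup>2 = 0\<close>, so \<open>\<alpha>\<close> vanishes on \<open>L\<close>.\<close>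
lemma bracket_normal_form:
  "(\<exists>e u. h8_bracket e u) \<or> (\<exists>e p u w. h16_bracket e p u w)"
proof -
  have "(UNIV :: 'a set) \<noteq> {0}"
  proof
    assume z: "(UNIV :: 'a set) = {0}"
    have "br x y = 0" for x y using z by blast
    with nonabelian show False by (simp add: abelian_lie_def)
  qed
  then obtain e where e: "g e e = 1" "\<And>x y. br x y \<in> perp e"
    using closed_10_form[of UNIV] by (auto simp: perp_def)
  define K where "K = perp e"
  have K: "subspace K" "\<And>y. y \<in> K \<Longrightarrow> J y \<in> K" "\<And>x y. br x y \<in> K"
    unfolding K_def by (rule subspace_perp, rule J_perp, assumption, rule e(2))
  show ?thesis
  proof (cases "\<forall>x\<in>K. \<forall>y\<in>K. br x y = 0")
    case True
    then interpret abelian_ideal br J g \<alpha> e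
      by unfold_locales (use e in \<open>auto simp: K_def\<close>)
    show ?thesis by (rule bracket_normal_form_if_perp_abelian)
  next
    case False
    then obtain x y where xy: "x \<in> K" "y \<in> K" "br x y \<noteq> 0" by blast
    then have "K \<noteq> {0}" by auto
    then obtain e' where e': "e' \<in> K" "g e' e' = 1" "\<And>x y. x \<in> K \<Longrightarrow> y \<in> K \<Longrightarrow> br x y \<in> perp e'"
      using closed_10_form[OF K(1,2)] K(3) perpI by metis
    have ee': "g e e' = 0" "g e (J e') = 0"
      using perpD[of e' e] e'(1) g_sym[of e e'] g_J_left[of e e'] g_sym[of "J e" e'] by (auto simp: K_def)
    obtain f where F: "unitary_frame e e' f"
      using unitary_frame_complete[OF e(1) e'(2) ee'] by blast
    note G = unitary_frame_g[OF F]
    define L where "L = K \<inter> perp e'"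
    have L: "subspace L" "\<And>y. y \<in> L \<Longrightarrow> J y \<in> L" "L \<subseteq> K"
      unfolding L_def using K J_perp by (auto intro: subspace_inter subspace_perp)
    have KK: "br x y \<in> L" if "x \<in> K" "y \<in> K" for x y
      unfolding L_def using K(3) e'(3) that by blast
    have exL: "y = g y f *\<^sub>R f + g y (J f) *\<^sub>R J f" if "y \<in> L" for y
      using frame_expand[OF F, of y] that perpD[of y e] perpD[of y e'] by (simp add: L_def K_def)
    have exK: "y - (g y e' *\<^sub>R e' + g y (J e') *\<^sub>R J e') \<in> L" if "y \<in> K" for y
      unfolding L_def K_def using that perpD[of y e] G by (auto simp: K_def intro!: perpI)
    have fL: "f \<in> L" unfolding L_def K_def using G by (auto intro!: perpI)
    have inK: "e' \<in> K" "J e' \<in> K" "f \<in> K" "J f \<in> K" using e' K fL L by blast+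
    have eng0: "br a y = 0 \<and> br (J a) y = 0"
      if "\<And>y. y \<in> L \<Longrightarrow> br a y \<in> L" "\<And>y. y \<in> L \<Longrightarrow> br (J a) y \<in> L" "y \<in> L" for a y
    proof -
      have "br a y \<in> {0} \<and> br (J a) y \<in> {0}"
      proof (rule nilpotent_on_complex_line[where M = L and m = f])
        show "\<exists>s t. y - (s *\<^sub>R f + t *\<^sub>R J f) \<in> {0}" if "y \<in> L" for y
          using exL[OF that] by (metis singletonI right_minus_eq)
      qed (use that L subspace_0[OF L(1)] in \<open>simp_all\<close>)
      then show ?thesis by simp
    qed
    have e'L: "br e' y = 0" "br (J e') y = 0" if "y \<in> L" for y
      using eng0[of e'] KK inK L(3) that by blast+
    have fLz: "br f y = 0" "br (J f) y = 0" if "y \<in> L" for y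
      using eng0[of f] KK inK L(3) that by blast+
    have LL: "br z y = 0" if "z \<in> L" "y \<in> L" for z y
      by (subst exL[OF that(1)]) (simp add: fLz that)
    have KL: "br k y = 0" "br y k = 0" if "k \<in> K" "y \<in> L" for k y
    proof -
      have "br (k - (g k e' *\<^sub>R e' + g k (J e') *\<^sub>R J e')) y = 0" using LL exK that by blast
      then show "br k y = 0" using e'L[OF that(2)] by simp
      then show "br y k = 0" using br_swap[of k y] by simp
    qed
    define v where "v = br e' (J e')"
    have v0: "v \<noteq> 0"
    proof
      assume "v = 0"
      then have 0: "br e' (J e') = 0" "br (J e') e' = 0" using br_swap[of e' "J e'"] by (simp_all add: v_def)
      let ?r = "\<lambda>k. k - (g k e' *\<^sub>R e' + g k (J e') *\<^sub>R J e')"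
      have r: "br e' (?r k) = 0" "br (J e') (?r k) = 0" "br (?r x) k = 0" if "k \<in> K" for k
        using KL exK[OF that] exK[OF xy(1)] inK that by blast+
      have e'k: "br e' k = 0" "br (J e') k = 0" if "k \<in> K" for k
        using r[OF that] 0 by simp_all
      have "br x y = 0" using r(3)[OF xy(2)] e'k[OF xy(2)] by simp
      with xy show False by simp
    qed
    have centK: "z \<in> L" if z: "z \<in> K" "\<And>k. k \<in> K \<Longrightarrow> br k z = 0" for z
    proof -
      let ?r = "z - (g z e' *\<^sub>R e' + g z (J e') *\<^sub>R J e')"
      have r: "br e' ?r = 0" "br (J e') ?r = 0" using KL exK[OF z(1)] inK by blast+
      have "g z (J e') *\<^sub>R v = 0" using r(1) z(2)[OF inK(1)] by (simp add: v_def)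
      moreover have "g z e' *\<^sub>R v = 0"
        using r(2) z(2)[OF inK(2)] br_swap[of e' "J e'"] by (simp add: v_def)
      ultimately have "g z e' = 0" "g z (J e') = 0" using v0 by auto
      then show ?thesis using z(1) by (simp add: L_def perp_def)
    qed
    have aL: "br a l \<in> L" if l: "l \<in> L" for a l
    proof (rule centK[OF K(3)])
      fix k assume k: "k \<in> K"
      show "br k (br a l) = 0"
        using jacobi[of a l k] KL[OF k l] KL[OF K(3) l, of k a] by simp
    qed
    have Lc: "br z y = 0" if y: "y \<in> L" for z y
    proof -
      have e0: "br e y = 0" "br (J e) y = 0" using eng0[of e] aL y by blast+
      define k where "k = z - (g z e *\<^sub>R e + g z (J e) *\<^sub>R J e)"
      have "k \<in> K" unfolding K_def by (rule perpI) (simp_all add: k_def e)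
      then have "br k y = 0" using KL y by blast
      then show ?thesis using e0 by (simp add: k_def)
    qed
    have eK: "br e k \<in> L \<and> br (J e) k \<in> L" if "k \<in> K" for k
    proof (rule nilpotent_on_complex_line[where M = K and m = e'])
      show "\<exists>s t. y - (s *\<^sub>R e' + t *\<^sub>R J e') \<in> L" if "y \<in> K" for y using exK[OF that] by blast
      show "br e y \<in> K" "br (J e) y \<in> K" for y by (rule K(3))+
      show "subspace L" "subspace K" "L \<subseteq> K" "k \<in> K" by (rule L K that)+
      show "J y \<in> L" "br e y \<in> L" "br (J e) y \<in> L" if "y \<in> L" for y
        using L(2) aL that by blast+
      show "J y \<in> K" if "y \<in> K" for y using K(2) that by blast
    qed
    have u: "br e (J e) \<in> L"
    proof (rule centK[OF K(3)])
      fix k assume k: "k \<in> K"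
      have "br k e \<in> L" using eK[OF k] br_swap[of k e] subspace_neg[OF L(1)] by metis
      then show "br k (br e (J e)) = 0"
        using jacobi[of e "J e" k] Lc eK[OF k] by simp
    qed
    have brL: "br a b \<in> L" for a b
    proof -
      define r where "r = (\<lambda>z. z - (g z e *\<^sub>R e + g z (J e) *\<^sub>R J e))"
      have rK: "r z \<in> K" for z unfolding K_def by (rule perpI) (simp_all add: r_def e)
      have ez: "br e (r z) \<in> L" "br (J e) (r z) \<in> L" "br (r z) (r y) \<in> L" for z y
        using eK[OF rK] KK[OF rK rK] by blast+
      have sw: "br (J e) e = - br e (J e)" "br (r b) e = - br e (r b)" "br (r b) (J e) = - br (J e) (r b)" for b
        by (rule br_swap)+
      have *: "z = g z e *\<^sub>R e + g z (J e) *\<^sub>R J e + r z" for z by (simp add: r_def)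
      have "br a b = br (g a e *\<^sub>R e + g a (J e) *\<^sub>R J e + r a) (g b e *\<^sub>R e + g b (J e) *\<^sub>R J e + r b)"
        by (rule arg_cong2[where f = br, OF * *])
      also have "\<dots> = (g a e * g b (J e) - g a (J e) * g b e) *\<^sub>R br e (J e) + g a e *\<^sub>R br e (r b)
          + g a (J e) *\<^sub>R br (J e) (r b) - g b e *\<^sub>R br e (r a) - g b (J e) *\<^sub>R br (J e) (r a) + br (r a) (r b)"
        by (simp add: sw) (simp add: algebra_simps)
      also have "\<dots> \<in> L"
        by (rule subspace_add[OF L(1) subspace_diff[OF L(1) subspace_diff[OF L(1) subspace_add[OF L(1)
          subspace_add[OF L(1) subspace_scale[OF L(1) u] subspace_scale[OF L(1) ez(1)]]
          subspace_scale[OF L(1) ez(2)]] subspace_scale[OF L(1) ez(1)]] subspace_scale[OF L(1) ez(2)]] ez(3)])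
      finally show ?thesis .
    qed
    have vL: "v \<in> L" "J v \<in> L" using brL[of e' "J e'"] L(2) by (simp_all add: v_def)
    have Lc': "br y z = 0" if "y \<in> L" for y z using Lc[OF that, of z] br_swap[of z y] by simp
    have \<alpha>v: "\<alpha> v = 0" by (simp add: v_def)
    have "\<alpha> (J v) * g v v = 0"
      using dH_at[of v "J v" e' "J e'"] Lc Lc' vL \<alpha>v br_swap[of e' "J e'"]
      by (simp add: torsion v_def[symmetric])
    then have \<alpha>Jv: "\<alpha> (J v) = 0" using v0 by simp
    define s t where "s = g v f" and "t = g v (J f)"
    have vf: "v = s *\<^sub>R f + t *\<^sub>R J f" using exL[OF vL(1)] by (simp add: s_def t_def)
    have "s * \<alpha> f + t * \<alpha> (J f) = 0" "s * \<alpha> (J f) - t * \<alpha> f = 0"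
      using \<alpha>v \<alpha>Jv unfolding vf by simp_all
    moreover have "(s\<^sup>2 + t\<^sup>2) * \<alpha> f = s * (s * \<alpha> f + t * \<alpha> (J f)) - t * (s * \<alpha> (J f) - t * \<alpha> f)"
      "(s\<^sup>2 + t\<^sup>2) * \<alpha> (J f) = t * (s * \<alpha> f + t * \<alpha> (J f)) + s * (s * \<alpha> (J f) - t * \<alpha> f)"
      by (simp_all add: power2_eq_square algebra_simps)
    ultimately have "(s\<^sup>2 + t\<^sup>2) * \<alpha> f = 0" "(s\<^sup>2 + t\<^sup>2) * \<alpha> (J f) = 0" by (simp_all only: mult_zero_right add_0 diff_0)
    moreover have "s\<^sup>2 + t\<^sup>2 \<noteq> 0" using vf v0 by (auto simp: sum_power2_eq_zero_iff)
    ultimately have \<alpha>f: "\<alpha> f = 0" "\<alpha> (J f) = 0" using mult_eq_0_iff by blast+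
    have \<alpha>L: "\<alpha> y = 0" if "y \<in> L" for y
      by (subst exL[OF that]) (simp add: \<alpha>f)
    define a where "a = \<alpha> e *\<^sub>R e + \<alpha> (J e) *\<^sub>R J e + \<alpha> e' *\<^sub>R e' + \<alpha> (J e') *\<^sub>R J e'"
    have riesz: "\<alpha> z = g a z" for z
    proof -
      have "\<alpha> z = \<alpha> (g z e *\<^sub>R e + g z (J e) *\<^sub>R J e + g z e' *\<^sub>R e' + g z (J e') *\<^sub>R J e'
          + g z f *\<^sub>R f + g z (J f) *\<^sub>R J f)"
        by (rule arg_cong[where f = \<alpha>, OF frame_expand[OF F]])
      also have "\<dots> = g z a" by (simp add: a_def \<alpha>f mult.commute)
      finally show ?thesis by (simp add: g_sym)
    qed
    have "a \<noteq> 0"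
    proof
      assume "a = 0"
      then have "\<alpha> = (\<lambda>x. 0)" using riesz by auto
      with \<alpha>_nonzero show False by simp
    qed
    then obtain t where t: "t > 0" "g (t *\<^sub>R a) (t *\<^sub>R a) = 1" using normalize by blast
    have "h8_bracket (J (t *\<^sub>R a)) (br (J (t *\<^sub>R a)) (J (J (t *\<^sub>R a))))"
    proof (rule derived_in_central_line[OF L(1,2) Lc brL \<alpha>L t(2)])
      show "1 / t \<noteq> 0" using t by simp
      show "\<alpha> z = 1 / t * g (t *\<^sub>R a) z" for z using t riesz by simp
    qed
    then show ?thesis by blast
  qed
qed

end

section \<open>Geometry of the two normal forms\<close>

lemma all_6: "(\<forall>i::6. P i) \<longleftrightarrow> P 1 \<and> P 2 \<and> P 3 \<and> P 4 \<and> P 5 \<and> P 6"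
proof
  have "(0::6) = 6" by simp
  assume P: "P 1 \<and> P 2 \<and> P 3 \<and> P 4 \<and> P 5 \<and> P 6"
  show "\<forall>i. P i"
  proof
    fix i :: 6
    show "P i"
    proof (cases i)
      case (of_int z)
      then have "z = 0 \<or> z = 1 \<or> z = 2 \<or> z = 3 \<or> z = 4 \<or> z = 5" by auto
      moreover have "P 0" using P \<open>(0::6) = 6\<close> by metis
      ultimately show ?thesis using P of_int by auto
    qed
  qed
qed simp

lemma Lambda2_wedge:
  assumes "finite S" "\<theta> \<in> S" "\<eta> \<in> S"
  shows "(\<lambda>x y. c * wedge11 \<theta> \<eta> x y) \<in> Lambda2 S"
proof -
  have "(\<Sum>\<theta>'\<in>S. \<Sum>\<eta>'\<in>S. (if \<theta>' = \<theta> \<and> \<eta>' = \<eta> then c else 0) * wedge11 \<theta>' \<eta>' x y)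
      = c * wedge11 \<theta> \<eta> x y" for x y
  proof -
    have "(\<Sum>\<theta>'\<in>S. \<Sum>\<eta>'\<in>S. (if \<theta>' = \<theta> \<and> \<eta>' = \<eta> then c else 0) * wedge11 \<theta>' \<eta>' x y)
      = (\<Sum>\<theta>'\<in>S. if \<theta>' = \<theta> then \<Sum>\<eta>'\<in>S. if \<eta>' = \<eta> then c * wedge11 \<theta> \<eta> x y else 0 else 0)"
      by (intro sum.cong refl) (auto intro!: sum.cong)
    then show ?thesis using assms by simp
  qed
  then show ?thesis unfolding Lambda2_def
    by (intro CollectI exI[of _ "\<lambda>\<theta>' \<eta>'. if \<theta>' = \<theta> \<and> \<eta>' = \<eta> then c else 0"]) (simp only:)
qed

lemma Lambda2_add:
  assumes "\<beta> \<in> Lambda2 S" "\<gamma> \<in> Lambda2 S"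
  shows "(\<lambda>x y. \<beta> x y + \<gamma> x y) \<in> Lambda2 S"
proof -
  obtain c d where "\<beta> = (\<lambda>x y. \<Sum>\<theta>\<in>S. \<Sum>\<eta>\<in>S. c \<theta> \<eta> * wedge11 \<theta> \<eta> x y)"
    "\<gamma> = (\<lambda>x y. \<Sum>\<theta>\<in>S. \<Sum>\<eta>\<in>S. d \<theta> \<eta> * wedge11 \<theta> \<eta> x y)"
    using assms unfolding Lambda2_def by blast
  then show ?thesis unfolding Lambda2_def
    by (intro CollectI exI[of _ "\<lambda>\<theta> \<eta>. c \<theta> \<eta> + d \<theta> \<eta>"]) (simp add: distrib_right sum.distrib)
qed

context hermitian_nilpotent begin

lemma bij_to_R6:
  fixes f :: "'a \<Rightarrow> real^6"
  assumes "linear f" "\<And>x. f x = 0 \<Longrightarrow> x = 0"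
  shows "bij f"
proof -
  have inj: "inj f" using assms linear_injective_0 by blast
  obtain B :: "'a set" where B: "finite B" "independent B" "card B = 6" using finite_basis by blast
  have "independent (f ` B)" using linear_independent_injective_image[OF assms(1) B(2)] inj by (simp add: inj_on_subset)
  moreover have "card (f ` B) = 6" using B inj by (simp add: card_image inj_on_subset)
  ultimately have "UNIV \<subseteq> span (f ` B)"
    by (intro card_ge_dim_independent) (auto simp: dim_UNIV)
  also have "span (f ` B) = f ` span B" by (rule linear_span_image[OF assms(1)])
  finally have "surj f" by auto
  with inj show ?thesis by (simp add: bij_def)
qed

text \<open>\<open>J\<close> preserves \<open>e \<and> Je\<close>, and \<open>H = (e \<and> Je) \<and> u\<close> up to sign; so \<open>dH\<close> is a multiple of
  \<open>(e \<and> Je) \<and> (e \<and> Je) = 0\<close>.\<close>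
lemma h8_bracket_consequences:
  assumes E: "h8_bracket e u"
  shows "br (J x) (J y) = br x y"
    and "d3 br (bismut_torsion br J g) = (\<lambda>x y z w. 0)"
proof -
  have br: "br x y = (g x e * g y (J e) - g x (J e) * g y e) *\<^sub>R u" for x y
    using E by (simp add: h8_bracket_def)
  have u: "g u e = 0" "g u (J e) = 0" using E by (simp_all add: h8_bracket_def)
  show "br (J x) (J y) = br x y"
    unfolding br by (simp add: g_J_left algebra_simps)
  show "d3 br (bismut_torsion br J g) = (\<lambda>x y z w. 0)"
  proof (intro ext)
    fix x y z w
    define W where "W x y = g x e * g y (J e) - g x (J e) * g y e" for x y
    have H: "bismut_torsion br J g x y z = W x y * g u z + W y z * g u x + W z x * g u y" for x y z
      unfolding torsion br by (simp add: W_def g_J_left algebra_simps)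
    have Hu: "bismut_torsion br J g (br x y) z w = W x y * W z w * g u u" for x y z w
      unfolding H br W_def[symmetric] by (simp add: W_def u)
    \<comment> \<open>The Pluecker relation of the decomposable form \<open>W\<close>.\<close>
    have "W x y * W z w - W x z * W y w + W x w * W y z = 0"
      unfolding W_def by algebra
    then have "g u u * (W x y * W z w - W x z * W y w + W x w * W y z) = 0" by simp
    then show "d3 br (bismut_torsion br J g) x y z w = 0"
      unfolding d3_def Hu by (simp add: algebra_simps)
  qed
qed

lemma h8_bracket_iso:
  assumes E: "h8_bracket e u" and "\<not> abelian_lie br"
  shows "lie_isomorphic br h8"
proof -
  have br: "br x y = (g x e * g y (J e) - g x (J e) * g y e) *\<^sub>R u" for x y
    using E by (simp add: h8_bracket_def)
  have u: "g e e = 1" "g u e = 0" "g u (J e) = 0" using E by (simp_all add: h8_bracket_def)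
  have "u \<noteq> 0" using assms(2) by (auto simp: abelian_lie_def br)
  then obtain t where t: "t > 0" "g (t *\<^sub>R u) (t *\<^sub>R u) = 1" using normalize by blast
  define q where "q = t *\<^sub>R u"
  have q: "g q q = 1" "g e q = 0" "g e (J q) = 0"
    using t u g_sym[of e u] g_J_left[of e u] g_sym[of "J e" u] by (auto simp: q_def)
  obtain p where F: "unitary_frame e q p" using unitary_frame_complete[OF u(1) q] by blast
  have gu: "g u q = 1 / t" "g u p = 0" "g u (J p) = 0" "g u (J q) = 0"
    using t unitary_frame_g(8,9)[OF F] by (auto simp: q_def field_simps)
  define f :: "'a \<Rightarrow> real^6" where
    "f x = (\<chi> i. if i = 1 then g x e else if i = 2 then g x (J e) else if i = 3 then g x (J q)
       else if i = 4 then g x p else if i = 5 then g x (J p) else - t * g x q)" for x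
  have lin: "linear f"
    by (rule linearI) (simp_all add: f_def vec_eq_iff algebra_simps)
  have "bij f"
  proof (rule bij_to_R6[OF lin])
    fix x assume "f x = 0"
    then have "g x e = 0" "g x (J e) = 0" "g x q = 0" "g x (J q) = 0" "g x p = 0" "g x (J p) = 0"
      using t(1) by (simp_all add: f_def vec_eq_iff all_6)
    then show "x = 0" using frame_expand[OF F, of x] by simp
  qed
  moreover have "f (br x y) = h8 (f x) (f y)" for x y
    using t(1) unfolding br
    by (simp add: f_def h8_def vec_eq_iff all_6 coform_def wedge11_def u gu)
  ultimately show ?thesis unfolding lie_isomorphic_def using lin by blast
qed

lemma h16_bracketD:
  assumes "h16_bracket e p u w"
  shows "br x y = (g x e * g y (J e) - g x (J e) * g y e) *\<^sub>R u
        + (g x e * g y (J p) - g x (J p) * g y e) *\<^sub>R w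
        + (g x (J e) * g y (J p) - g x (J p) * g y (J e)) *\<^sub>R J w"
    and "g e e = 1" "g p p = 1" "g e p = 0" "g e (J p) = 0" "g (J e) p = 0" "g p e = 0" "g p (J e) = 0" "g (J p) e = 0"
    and "w \<noteq> 0" "g w e = 0" "g w (J e) = 0" "g w p = 0" "g w (J p) = 0"
    "g (J w) e = 0" "g (J w) p = 0" "g e w = 0" "g e (J w) = 0" "g p w = 0" "g p (J w) = 0"
    "g (J p) w = 0"
    and "g u e = 0" "g u (J e) = 0" "g u p = 0" "g u (J p) \<noteq> 0" "g e u = 0" "g (J e) u = 0"
proof -
  show "br x y = (g x e * g y (J e) - g x (J e) * g y e) *\<^sub>R u
        + (g x e * g y (J p) - g x (J p) * g y e) *\<^sub>R w
        + (g x (J e) * g y (J p) - g x (J p) * g y (J e)) *\<^sub>R J w"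
    using assms unfolding h16_bracket_def by blast
qed (use assms in \<open>auto simp: h16_bracket_def perp_def g_sym[of p e] g_sym[of "J p" e] g_sym[of p "J e"]
  g_sym[of e w] g_sym[of p w] g_sym[of e "J w"] g_sym[of p "J w"] g_sym[of "J p" w] g_sym[of e u]
  g_sym[of "J e" u] g_J_left[of e p] g_J_left[of w]\<close>)

text \<open>The coordinates along \<open>w\<close> and \<open>Jw\<close> are sheared by that along \<open>Jp\<close> so that \<open>u\<close> becomes a multiple of
  the fourth basis vector; the scalings absorb \<open>c = g(u,Jp)\<close> and \<open>|w|\<^sup>2 = 1/t\<^sup>2\<close>.\<close>
lemma h16_bracket_iso:
  assumes E: "h16_bracket e p u w"
  shows "lie_isomorphic br h16"
proof -
  note D = h16_bracketD[OF E]
  obtain t where t: "t > 0" "g (t *\<^sub>R w) (t *\<^sub>R w) = 1" using normalize[OF D(10)] by blast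
  define q where "q = t *\<^sub>R w"
  have q: "g q q = 1" using t by (simp only: q_def)
  have F: "unitary_frame e p q"
    by (simp add: unitary_frame_def q D) (simp add: q_def D)
  have gw: "g w w = 1 / t\<^sup>2" using t by (simp add: field_simps power2_eq_square)
  define c s where "c = g u (J p)" and "s = t\<^sup>2 / c"
  have c: "c \<noteq> 0" "s \<noteq> 0" "t\<^sup>2 \<noteq> 0" using D(25) t by (simp_all add: c_def s_def)
  define f :: "'a \<Rightarrow> real^6" where
    "f x = (\<chi> i. if i = 1 then g x e else if i = 2 then g x (J e) else if i = 3 then g x p
       else if i = 4 then - (g x (J p) / c) else if i = 5 then s * (g x w - g u w / c * g x (J p))
       else s * (g x (J w) - g u (J w) / c * g x (J p)))" for x
  have lin: "linear f"
    by (rule linearI) (simp_all add: f_def vec_eq_iff algebra_simps add_divide_distrib)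
  have "bij f"
  proof (rule bij_to_R6[OF lin])
    fix x assume "f x = 0"
    then have "g x e = 0" "g x (J e) = 0" "g x p = 0" "g x (J p) = 0" "g x w = 0" "g x (J w) = 0"
      using c by (simp_all add: f_def vec_eq_iff all_6)
    then show "x = 0" using frame_expand[OF F, of x] by (simp add: q_def)
  qed
  moreover have "f (br x y) = h16 (f x) (f y)" for x y
  proof -
    define W V V' where "W = g x e * g y (J e) - g x (J e) * g y e"
      and "V = g x e * g y (J p) - g x (J p) * g y e"
      and "V' = g x (J e) * g y (J p) - g x (J p) * g y (J e)"
    have b: "br x y = W *\<^sub>R u + V *\<^sub>R w + V' *\<^sub>R J w"
      unfolding W_def V_def V'_def by (rule D(1))
    have e: "h16 (f x) (f y) $ 4 = - W" "h16 (f x) (f y) $ 5 = V / c" "h16 (f x) (f y) $ 6 = V' / c"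
      "h16 (f x) (f y) $ 1 = 0" "h16 (f x) (f y) $ 2 = 0" "h16 (f x) (f y) $ 3 = 0"
      by (simp_all add: h16_def coform_def wedge11_def f_def W_def V_def V'_def field_simps c)
    have Jwe: "g (J w) (J e) = 0" "g (J w) (J p) = 0" by (simp_all add: D)
    have gb: "g (br x y) (J p) = W * c" "g (br x y) w = W * g u w + V / t\<^sup>2" "g (br x y) (J w) = W * g u (J w) + V' / t\<^sup>2"
      unfolding b by (simp_all add: D gw c_def)
    have st: "X * s / t\<^sup>2 = X / c" "s * X / t\<^sup>2 = X / c" for X using c by (simp_all add: s_def)
    then show ?thesis
      unfolding vec_eq_iff all_6 e unfolding f_def
      by (simp add: gb c) (simp add: b D st algebra_simps)
  qed
  ultimately show ?thesis unfolding lie_isomorphic_def using lin by blast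
qed

text \<open>Only \<open>[e,Jp] = w\<close> and \<open>[Je,Jp] = Jw\<close> contribute to the component \<open>(e,Je,p,Jp)\<close> of \<open>dH\<close>, which is
  \<open>|w|\<^sup>2 + |Jw|\<^sup>2\<close>.\<close>
lemma h16_bracket_torsion:
  assumes E: "h16_bracket e p u w"
  shows "d3 br (bismut_torsion br J g) \<noteq> (\<lambda>x y z w. 0)"
    and "br (J e) (J p) \<noteq> br e p"
proof -
  note D = h16_bracketD[OF E]
  have b: "br e (J e) = u" "br e p = 0" "br e (J p) = w" "br (J e) (J p) = J w" "br (J e) p = 0"
    "br p (J p) = 0"
    by (subst D(1); simp add: D)+
  show "br (J e) (J p) \<noteq> br e p" by (simp add: b D)
  have K: "br x y = 0" if "g x e = 0" "g x (J e) = 0" "g y e = 0" "g y (J e) = 0" for x y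
    by (subst D(1)) (simp add: that)
  have wz: "br z w = 0" "br w z = 0" "br z (J w) = 0" "br (J w) z = 0" for z
    by (subst D(1); simp add: D)+
  let ?H = "bismut_torsion br J g"
  have H1: "?H u p (J p) = 0"
    unfolding torsion by (simp add: K D g_J_left[of u])
  have H2: "?H w (J e) (J p) = 0 + g (br (- e) (- p)) w" "?H w (J e) p = - g (br e (J p)) w"
    "?H (J w) e p = g (br (J e) (J p)) (J w)"
    unfolding torsion by (simp_all add: wz)
  have H3: "?H 0 y z = 0" for y z by (simp add: torsion)
  have "d3 br ?H e (J e) p (J p) = 2 * g w w"
    unfolding d3_def b H1 H2 H3 by (simp add: b)
  moreover have "g w w \<noteq> 0" using D(10) by simp
  ultimately show "d3 br ?H \<noteq> (\<lambda>x y z w. 0)" by auto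
qed

text \<open>For a unitary frame these are the \<open>(1,0)\<close>-forms dual to it over \<open>\<complex>\<close>.\<close>
definition dual10 :: "'a \<Rightarrow> 'a \<Rightarrow> complex" where
  "dual10 a x = Complex (g x a) (g x (J a))"

lemma dual10_forms10: "dual10 a \<in> forms10 J"
  unfolding forms10_def
  by (auto intro!: linearI simp: dual10_def complex_eq_iff g_J_left)

lemma frame_basis_forms10:
  assumes F: "unitary_frame a b c"
  shows "basis_forms10 J 3 (\<lambda>j. if j = 1 then dual10 a else if j = 2 then dual10 b else dual10 c)"
    (is "basis_forms10 J 3 ?\<omega>")
proof -
  note G = unitary_frame_g[OF F]
  have S: "(\<Sum>j=1..3. k j * ?\<omega> j x) = k 1 * dual10 a x + k 2 * dual10 b x + k 3 * dual10 c x"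
    for k :: "nat \<Rightarrow> complex" and x
    by (simp add: eval_nat_numeral)
  have d: "dual10 a a = 1" "dual10 b a = 0" "dual10 c a = 0" "dual10 a b = 0" "dual10 b b = 1"
    "dual10 c b = 0" "dual10 a c = 0" "dual10 b c = 0" "dual10 c c = 1"
    by (simp_all add: dual10_def G complex_eq_iff)
  show ?thesis
    unfolding basis_forms10_def
  proof (intro conjI ballI allI impI)
    fix j show "?\<omega> j \<in> forms10 J" by (simp add: dual10_forms10)
  next
    fix k :: "nat \<Rightarrow> complex" and j :: nat
    assume k: "\<forall>x. (\<Sum>j=1..3. k j * ?\<omega> j x) = 0" and j: "j \<in> {1..3}"
    have "k 1 = 0" "k 2 = 0" "k 3 = 0"
      using k[unfolded S, rule_format, of a] k[unfolded S, rule_format, of b]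
        k[unfolded S, rule_format, of c] by (simp_all add: d)
    moreover have "j = 1 \<or> j = 2 \<or> j = 3" using j by auto
    ultimately show "k j = 0" by auto
  next
    fix \<theta> assume "\<theta> \<in> forms10 J"
    then have lin: "linear \<theta>" and J: "\<theta> (J x) = \<i> * \<theta> x" for x by (auto simp: forms10_def)
    have "\<theta> x = \<theta> a * dual10 a x + \<theta> b * dual10 b x + \<theta> c * dual10 c x" for x
    proof -
      have "\<theta> x = \<theta> (g x a *\<^sub>R a + g x (J a) *\<^sub>R J a + g x b *\<^sub>R b + g x (J b) *\<^sub>R J b
        + g x c *\<^sub>R c + g x (J c) *\<^sub>R J c)"
        by (rule arg_cong[where f = \<theta>, OF frame_expand[OF F]])
      also have "\<dots> = \<theta> a * dual10 a x + \<theta> b * dual10 b x + \<theta> c * dual10 c x"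
        by (simp add: linear_add[OF lin] linear_scale[OF lin] J dual10_def Complex_eq scaleR_conv_of_real
          algebra_simps)
      finally show ?thesis .
    qed
    note * = this
    define k where "k j = (if j = 1 then \<theta> a else if j = 2 then \<theta> b else \<theta> c)" for j :: nat
    have k: "k 1 = \<theta> a" "k 2 = \<theta> b" "k 3 = \<theta> c" by (simp_all add: k_def)
    show "\<exists>k. \<forall>x. \<theta> x = (\<Sum>j=1..3. k j * ?\<omega> j x)"
      unfolding S by (intro exI[of _ k] allI, unfold k, rule *)
  qed
qed

text \<open>For the forms \<open>\<omega>\<^sup>1, \<omega>\<^sup>2, \<omega>\<^sup>3\<close> dual to \<open>e, p, w/|w|\<close>, \<open>d\<omega>\<^sup>2\<close> is a multiple of
  \<open>\<omega>\<^sup>1 \<and> cnj \<omega>\<^sup>1\<close>, and \<open>d\<omega>\<^sup>3\<close> adds a multiple of \<open>\<omega>\<^sup>1 \<and> (\<omega>\<^sup>2 - cnj \<omega>\<^sup>2)\<close>: the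
  covector of \<open>Jp\<close> is \<open>(\<omega>\<^sup>2 - cnj \<omega>\<^sup>2)/2i\<close>.\<close>
lemma h16_bracket_nilpotent:
  assumes E: "h16_bracket e p u w"
  shows "nilpotent_complex_structure br J"
proof -
  note D = h16_bracketD[OF E]
  obtain t where t: "t > 0" "g (t *\<^sub>R w) (t *\<^sub>R w) = 1" using normalize[OF D(10)] by blast
  define q where "q = t *\<^sub>R w"
  have q: "g q q = 1" using t by (simp only: q_def)
  have F: "unitary_frame e p q"
    by (simp add: unitary_frame_def q D) (simp add: q_def D)
  define \<omega> where "\<omega> = (\<lambda>j::nat. if j = 1 then dual10 e else if j = 2 then dual10 p else dual10 q)"
  let ?E = "dual10 e" and ?P = "dual10 p"
  define r where "r = g w q"
  have wq: "g w q = r" "g w (J q) = 0" "g (J w) q = 0" by (simp_all add: q_def r_def g_J_left)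
  define W V V' where "W x y = g x e * g y (J e) - g x (J e) * g y e"
    and "V x y = g x e * g y (J p) - g x (J p) * g y e"
    and "V' x y = g x (J e) * g y (J p) - g x (J p) * g y (J e)" for x y
  have b: "br x y = W x y *\<^sub>R u + V x y *\<^sub>R w + V' x y *\<^sub>R J w" for x y
    unfolding W_def V_def V'_def by (rule D(1))
  have wedges: "wedge11 ?E (cnj \<circ> ?E) x y = - 2 * \<i> * W x y"
    "wedge11 ?E ?P x y - wedge11 ?E (cnj \<circ> ?P) x y = 2 * \<i> * (V x y + \<i> * V' x y)" for x y
    by (simp_all add: wedge11_def dual10_def complex_eq_iff W_def V_def V'_def algebra_simps)
  have d1: "d1 br (\<omega> 1) = (\<lambda>x y. 0)"
    by (intro ext) (simp add: d1_def \<omega>_def b dual10_def D complex_eq_iff)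
  have d2: "d1 br (\<omega> 2) = (\<lambda>x y. (g u (J p) / 2) * wedge11 ?E (cnj \<circ> ?E) x y)"
    unfolding wedges
    by (intro ext) (simp add: d1_def \<omega>_def b dual10_def D complex_eq_iff)
  have d3: "d1 br (\<omega> 3) = (\<lambda>x y. (dual10 q u / (2 * \<i>)) * wedge11 ?E (cnj \<circ> ?E) x y
      + ((- r / (2 * \<i>)) * wedge11 ?E ?P x y + (r / (2 * \<i>)) * wedge11 ?E (cnj \<circ> ?P) x y))"
  proof (intro ext)
    fix x y
    have "X / (2 * \<i>) * (2 * \<i>) = X" for X
      unfolding times_divide_eq_left by (rule nonzero_mult_div_cancel_right) simp
    then have i2: "X / (2 * \<i>) * (2 * \<i> * z) = X * z" "X / (2 * \<i>) * (- 2 * \<i> * z) = - (X * z)" for X z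
      by (metis mult.assoc, metis mult.assoc mult_minus_left mult_minus_right)
    have "(dual10 q u / (2 * \<i>)) * wedge11 ?E (cnj \<circ> ?E) x y
      + ((- r / (2 * \<i>)) * wedge11 ?E ?P x y + (r / (2 * \<i>)) * wedge11 ?E (cnj \<circ> ?P) x y)
      = (dual10 q u / (2 * \<i>)) * wedge11 ?E (cnj \<circ> ?E) x y
        - r / (2 * \<i>) * (wedge11 ?E ?P x y - wedge11 ?E (cnj \<circ> ?P) x y)"
      by (simp add: algebra_simps)
    also have "\<dots> = - (dual10 q u * W x y) - r * (V x y + \<i> * V' x y)"
      unfolding wedges i2 by simp
    also have "\<dots> = d1 br (\<omega> 3) x y"
      by (simp add: d1_def \<omega>_def b dual10_def wq complex_eq_iff algebra_simps)
    finally show "d1 br (\<omega> 3) x y = (dual10 q u / (2 * \<i>)) * wedge11 ?E (cnj \<circ> ?E) x y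
      + ((- r / (2 * \<i>)) * wedge11 ?E ?P x y + (r / (2 * \<i>)) * wedge11 ?E (cnj \<circ> ?P) x y)"
      by (rule sym)
  qed
  have "basis_forms10 J 3 \<omega>" unfolding \<omega>_def by (rule frame_basis_forms10[OF F])
  moreover have "\<forall>j\<in>{2..3}. d1 br (\<omega> j) \<in> Lambda2 (\<omega> ` {1..<j} \<union> (\<lambda>i. cnj \<circ> \<omega> i) ` {1..<j})"
  proof
    fix j :: nat assume "j \<in> {2..3}"
    then consider "j = 2" | "j = 3" by force
    then show "d1 br (\<omega> j) \<in> Lambda2 (\<omega> ` {1..<j} \<union> (\<lambda>i. cnj \<circ> \<omega> i) ` {1..<j})"
    proof cases
      case 1
      have "?E = \<omega> 1" by (simp add: \<omega>_def)
      then show ?thesis unfolding 1 d2 by (intro Lambda2_wedge) auto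
    next
      case 2
      have "?E = \<omega> 1" "?P = \<omega> 2" by (simp_all add: \<omega>_def)
      then show ?thesis unfolding 2 d3 by (intro Lambda2_add Lambda2_wedge) auto
    qed
  qed
  moreover have "complex_structure br J" using hermitian by (simp add: hermitian_structure_def)
  moreover have "dim (UNIV :: 'a set) = 2 * 3" using dim_six by simp
  ultimately show ?thesis unfolding nilpotent_complex_structure_def using d1 by blast
qed

end

section \<open>LCSKT structures on the two Lie algebras\<close>

lemma UNIV_6: "(UNIV :: 6 set) = {1, 2, 3, 4, 5, 6}"
  using all_6[of "\<lambda>i. i \<in> {1, 2, 3, 4, 5, 6}"] by auto

lemma lcskt_transport:
  fixes br :: "'a::real_vector \<Rightarrow> 'a \<Rightarrow> 'a" and br' :: "'b::real_vector \<Rightarrow> 'b \<Rightarrow> 'b"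
  assumes "lie_isomorphic br br'" "lcskt br' J g"
  shows "\<exists>J g. lcskt br J g"
proof -
  obtain f where f: "linear f" "bij f" "\<And>x y. f (br x y) = br' (f x) (f y)"
    using assms(1) by (auto simp: lie_isomorphic_def)
  define h where "h = inv f"
  have fh: "f (h y) = y" for y using f(2) by (simp add: h_def bij_is_surj surj_f_inv_f)
  have hf: "h (f x) = x" for x using f(2) by (simp add: h_def bij_is_inj inv_f_f)
  have linh: "linear h"
    by (rule linearI; rule injD[OF bij_is_inj[OF f(2)]]) (simp_all add: fh linear_add[OF f(1)] linear_scale[OF f(1)])
  have brh: "br (h x) (h y) = h (br' x y)" for x y
    by (rule injD[OF bij_is_inj[OF f(2)]]) (simp add: fh f(3))
  have br: "br x y = h (br' (f x) (f y))" for x y by (simp add: hf brh[symmetric])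
  define J' where "J' = (\<lambda>x. h (J (f x)))"
  define g' where "g' = (\<lambda>x y. g (f x) (f y))"
  have H: "hermitian_structure br' J g" using assms(2) by (simp add: lcskt_def)
  have J: "linear J" "J (J x) = - x"
    "br' (J x) (J y) - J (br' (J x) y) - J (br' x (J y)) - br' x y = 0" for x y
    using H by (simp_all add: hermitian_structure_def complex_structure_def)
  have g: "bilinear g" "g x y = g y x" "x \<noteq> 0 \<Longrightarrow> g x x > 0" "g (J x) (J y) = g x y" for x y
    using H by (auto simp: hermitian_structure_def inner_product_def)
  have f0: "f x = 0 \<Longrightarrow> x = 0" for x using hf[of x] linear_0[OF linh] by simp
  have lJ: "linear J'"
    using linear_compose[OF linear_compose[OF f(1) J(1)] linh] by (simp add: J'_def o_def)
  have nij: "br (J' x) (J' y) - J' (br (J' x) y) - J' (br x (J' y)) - br x y = 0" for x y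
  proof -
    have "br (J' x) (J' y) - J' (br (J' x) y) - J' (br x (J' y)) - br x y
      = h (br' (J (f x)) (J (f y)) - J (br' (J (f x)) (f y)) - J (br' (f x) (J (f y))) - br' (f x) (f y))"
      by (simp add: br J'_def fh linear_diff[OF linh])
    then show ?thesis by (simp add: J linear_0[OF linh])
  qed
  have cs: "complex_structure br J'"
    unfolding complex_structure_def using lJ nij
    by (simp add: J'_def fh J linear_neg[OF linh] hf)
  have bil: "bilinear g'"
    unfolding bilinear_def g'_def
    using linear_compose[OF f(1)] g(1) unfolding bilinear_def o_def by blast
  have ip: "inner_product g'"
    unfolding inner_product_def using bil g(2,3) f0 by (auto simp: g'_def)
  have herm: "hermitian_structure br J' g'"
    unfolding hermitian_structure_def using cs ip g(4) by (simp add: J'_def g'_def fh)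
  have tor: "bismut_torsion br J' g' x y z = bismut_torsion br' J g (f x) (f y) (f z)" for x y z
    by (simp add: bismut_torsion_def d2_def fundamental_form_def g'_def J'_def fh f(3))
  obtain \<alpha> :: "'b \<Rightarrow> real" where \<alpha>: "linear \<alpha>" "\<alpha> \<noteq> (\<lambda>x. 0)" "d1 br' \<alpha> = (\<lambda>x y. 0)"
    "d3 br' (bismut_torsion br' J g) = wedge13 \<alpha> (bismut_torsion br' J g)"
    using assms(2) by (auto simp: lcskt_def)
  define \<alpha>' where "\<alpha>' = (\<lambda>x. \<alpha> (f x))"
  have "linear \<alpha>'" using linear_compose[OF f(1) \<alpha>(1)] by (simp add: \<alpha>'_def o_def)
  moreover have "\<alpha>' \<noteq> (\<lambda>x. 0)"
  proof
    assume "\<alpha>' = (\<lambda>x. 0)"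
    then have "\<alpha>' (h y) = 0" for y by (rule fun_cong)
    then have "\<alpha> y = 0" for y by (simp add: \<alpha>'_def fh)
    with \<alpha>(2) show False by auto
  qed
  moreover have "d1 br \<alpha>' = (\<lambda>x y. 0)"
    using fun_cong[OF fun_cong[OF \<alpha>(3)]] by (intro ext) (simp add: d1_def \<alpha>'_def f(3))
  moreover have "d3 br (bismut_torsion br J' g') = wedge13 \<alpha>' (bismut_torsion br J' g')"
  proof (intro ext)
    fix x y z w
    show "d3 br (bismut_torsion br J' g') x y z w = wedge13 \<alpha>' (bismut_torsion br J' g') x y z w"
      using fun_cong[OF fun_cong[OF fun_cong[OF fun_cong[OF \<alpha>(4)]]], of "f x" "f y" "f z" "f w"]
      by (simp add: d3_def wedge13_def tor f(3) \<alpha>'_def)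
  qed
  ultimately have "lcskt br J' g'" unfolding lcskt_def using herm by blast
  then show ?thesis by blast
qed

text \<open>On both algebras this is integrable and orthogonal for the standard inner product. In the normal
  forms above it corresponds to \<open>e = e\<^sub>1\<close>, \<open>u = - e\<^sub>6\<close> for \<open>\<hh>\<^sub>8\<close> and to \<open>e = e\<^sub>1\<close>, \<open>p = e\<^sub>3\<close>,
  \<open>u = - e\<^sub>4\<close>, \<open>w = - e\<^sub>5\<close> for \<open>\<hh>\<^sub>1\<^sub>6\<close>.\<close>
definition std_J :: "real^6 \<Rightarrow> real^6" where
  "std_J x = (\<chi> i. if i = 1 then - x $ 2 else if i = 2 then x $ 1 else if i = 3 then - x $ 4
     else if i = 4 then x $ 3 else if i = 5 then - x $ 6 else x $ 5)"

lemma std_J_nth [simp]: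
  "std_J x $ 1 = - x $ 2" "std_J x $ 2 = x $ 1" "std_J x $ 3 = - x $ 4"
  "std_J x $ 4 = x $ 3" "std_J x $ 5 = - x $ 6" "std_J x $ 6 = x $ 5"
  by (simp_all add: std_J_def)

lemma h8_nth: "h8 x y $ 1 = 0" "h8 x y $ 2 = 0" "h8 x y $ 3 = 0" "h8 x y $ 4 = 0" "h8 x y $ 5 = 0"
  "h8 x y $ 6 = x $ 2 * y $ 1 - x $ 1 * y $ 2"
  by (simp_all add: h8_def wedge11_def coform_def)

lemma h16_nth: "h16 x y $ 1 = 0" "h16 x y $ 2 = 0" "h16 x y $ 3 = 0"
  "h16 x y $ 4 = x $ 2 * y $ 1 - x $ 1 * y $ 2" "h16 x y $ 5 = x $ 4 * y $ 1 - x $ 1 * y $ 4"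
  "h16 x y $ 6 = x $ 4 * y $ 2 - x $ 2 * y $ 4"
  by (simp_all add: h16_def wedge11_def coform_def)

lemma inner_6: "(x :: real^6) \<bullet> y = x $ 1 * y $ 1 + x $ 2 * y $ 2 + x $ 3 * y $ 3 + x $ 4 * y $ 4
   + x $ 5 * y $ 5 + x $ 6 * y $ 6"
  unfolding inner_vec_def UNIV_6 by (simp add: add.assoc)

lemma vec_eq_6: "(x :: real^6) = y \<longleftrightarrow> x $ 1 = y $ 1 \<and> x $ 2 = y $ 2 \<and> x $ 3 = y $ 3 \<and> x $ 4 = y $ 4
   \<and> x $ 5 = y $ 5 \<and> x $ 6 = y $ 6"
  by (simp add: vec_eq_iff all_6)

lemma linear_std_J: "linear std_J"
  by (rule linearI) (simp_all add: vec_eq_6)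

lemma hermitian_std:
  assumes "\<And>x y. br (std_J x) (std_J y) - std_J (br (std_J x) y) - std_J (br x (std_J y)) - br x y = 0"
  shows "hermitian_structure br std_J (\<bullet>)"
proof -
  have "bilinear ((\<bullet>) :: real^6 \<Rightarrow> real^6 \<Rightarrow> real)"
    by (simp add: bilinear_def inner_add_left inner_add_right linearI)
  moreover have "std_J (std_J x) = - x" "std_J x \<bullet> std_J y = x \<bullet> y" for x y
    by (simp_all add: vec_eq_6 inner_6)
  ultimately show ?thesis
    unfolding hermitian_structure_def complex_structure_def inner_product_def
    using assms linear_std_J by (simp add: inner_commute)
qed

lemma lcskt_h8: "lcskt h8 std_J (\<bullet>)"
proof -
  have herm: "hermitian_structure h8 std_J (\<bullet>)"
    by (rule hermitian_std) (simp add: vec_eq_6 h8_nth algebra_simps)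
  have lin: "linear (\<lambda>x::real^6. x $ 1)" by (rule linearI) simp_all
  have nz: "(\<lambda>x::real^6. x $ 1) \<noteq> (\<lambda>x. 0)"
    by (auto simp: fun_eq_iff intro!: exI[of _ "axis 1 1"])
  have cl: "d1 h8 (\<lambda>x. x $ 1) = (\<lambda>x y. 0)" by (intro ext) (simp add: d1_def h8_nth)
  have t: "bismut_torsion h8 std_J (\<bullet>) x y z = (x $ 2 * y $ 1 - x $ 1 * y $ 2) * z $ 6
      + (y $ 2 * z $ 1 - y $ 1 * z $ 2) * x $ 6 + (z $ 2 * x $ 1 - z $ 1 * x $ 2) * y $ 6" for x y z
    by (simp add: bismut_torsion_def d2_def fundamental_form_def inner_6 h8_nth algebra_simps)
  have "d3 h8 (bismut_torsion h8 std_J (\<bullet>)) = wedge13 (\<lambda>x. x $ 1) (bismut_torsion h8 std_J (\<bullet>))"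
    by (intro ext) (simp add: d3_def wedge13_def t h8_nth, simp add: algebra_simps)
  then show ?thesis unfolding lcskt_def using herm lin nz cl by blast
qed

text \<open>The relation \<open>2|w|\<^sup>2 = \<alpha>(p) g(u,Jp)\<close> for \<open>p = e\<^sub>3\<close>, \<open>Jp = e\<^sub>4 = - u\<close> and \<open>w = - e\<^sub>5\<close> dictates
  \<open>\<alpha> = - 2 e\<^sup>3\<close>.\<close>
lemma lcskt_h16: "lcskt h16 std_J (\<bullet>)"
proof -
  let ?\<alpha> = "\<lambda>x::real^6. - 2 * x $ 3"
  have herm: "hermitian_structure h16 std_J (\<bullet>)"
    by (rule hermitian_std) (simp add: vec_eq_6 h16_nth algebra_simps)
  have lin: "linear ?\<alpha>" by (rule linearI) simp_all
  have nz: "?\<alpha> \<noteq> (\<lambda>x. 0)"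
    by (auto simp: fun_eq_iff intro!: exI[of _ "axis 3 1"])
  have cl: "d1 h16 ?\<alpha> = (\<lambda>x y. 0)" by (intro ext) (simp add: d1_def h16_nth)
  have t: "bismut_torsion h16 std_J (\<bullet>) x y z
      = (x $ 2 * y $ 1 - x $ 1 * y $ 2) * z $ 4 + (x $ 2 * y $ 3 - x $ 3 * y $ 2) * z $ 5 + (x $ 3 * y $ 1 - x $ 1 * y $ 3) * z $ 6
      + (y $ 2 * z $ 1 - y $ 1 * z $ 2) * x $ 4 + (y $ 2 * z $ 3 - y $ 3 * z $ 2) * x $ 5 + (y $ 3 * z $ 1 - y $ 1 * z $ 3) * x $ 6
      + (z $ 2 * x $ 1 - z $ 1 * x $ 2) * y $ 4 + (z $ 2 * x $ 3 - z $ 3 * x $ 2) * y $ 5 + (z $ 3 * x $ 1 - z $ 1 * x $ 3) * y $ 6"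
    for x y z
    by (simp add: bismut_torsion_def d2_def fundamental_form_def inner_6 h16_nth algebra_simps)
  have "d3 h16 (bismut_torsion h16 std_J (\<bullet>)) = wedge13 ?\<alpha> (bismut_torsion h16 std_J (\<bullet>))"
    by (intro ext) (simp add: d3_def wedge13_def t h16_nth, simp add: algebra_simps)
  then show ?thesis unfolding lcskt_def using herm lin nz cl by blast
qed

section \<open>The classification\<close>

text \<open>The nilpotency step is invariant under isomorphism; it is 2 for \<open>\<hh>\<^sub>8\<close> and 3 for \<open>\<hh>\<^sub>1\<^sub>6\<close>.\<close>
lemma lie_isomorphic_h8_two_step:
  assumes "lie_isomorphic br h8"
  shows "br x (br y z) = 0"
proof -
  obtain f where f: "linear f" "bij f" "\<And>x y. f (br x y) = h8 (f x) (f y)"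
    using assms by (auto simp: lie_isomorphic_def)
  have "f (br x (br y z)) = f 0"
    by (simp add: f(3) vec_eq_6 h8_nth linear_0[OF f(1)])
  then show ?thesis using f(2) by (simp add: bij_is_inj inj_eq)
qed

lemma lie_isomorphic_h16_not_two_step:
  assumes "lie_isomorphic br h16"
  shows "\<exists>x y. br x (br x y) \<noteq> 0"
proof -
  obtain f where f: "linear f" "bij f" "\<And>x y. f (br x y) = h16 (f x) (f y)"
    using assms by (auto simp: lie_isomorphic_def)
  obtain x y where xy: "f x = axis 1 1" "f y = axis 2 1"
    using f(2) by (metis bij_is_surj surjD)
  have "f (br x (br x y)) $ 5 = 1"
    by (simp add: f(3) h16_nth xy) (simp add: axis_def)
  then have "br x (br x y) \<noteq> 0" using linear_0[OF f(1)] by auto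
  then show ?thesis by blast
qed

lemma lcskt_dichotomy:
  fixes br :: "'a::real_vector \<Rightarrow> 'a \<Rightarrow> 'a"
  assumes "lie_algebra br" "dim (UNIV :: 'a set) = 6" "nilpotent_lie br" "\<not> abelian_lie br"
    and lcskt: "lcskt br J g"
  shows "lie_isomorphic br h8 \<and> abelian_complex_structure br J \<and> trivial_lcskt br J g \<or>
    lie_isomorphic br h16 \<and> nilpotent_complex_structure br J \<and>
      \<not> abelian_complex_structure br J \<and> nontrivial_lcskt br J g"
proof -
  obtain \<alpha> :: "'a \<Rightarrow> real" where "linear \<alpha>" "\<alpha> \<noteq> (\<lambda>x. 0)" "d1 br \<alpha> = (\<lambda>x y. 0)"
    "d3 br (bismut_torsion br J g) = wedge13 \<alpha> (bismut_torsion br J g)"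
    and herm: "hermitian_structure br J g"
    using lcskt unfolding lcskt_def by blast
  then interpret lcskt_nilpotent br J g \<alpha>
    using assms by (intro lcskt_nilpotent.intro hermitian_nilpotent.intro
        hermitian_nilpotent_axioms.intro lcskt_nilpotent_axioms.intro)
  have cs: "complex_structure br J" using herm by (simp add: hermitian_structure_def)
  from bracket_normal_form show ?thesis
  proof (elim disjE exE)
    fix e u assume E: "h8_bracket e u"
    have "abelian_complex_structure br J"
      unfolding abelian_complex_structure_def using cs h8_bracket_consequences(1)[OF E] by blast
    then show ?thesis
      using h8_bracket_iso[OF E nonabelian] h8_bracket_consequences(2)[OF E] lcskt
      by (simp add: trivial_lcskt_def)
  next
    fix e p u w assume E: "h16_bracket e p u w"
    have "\<not> abelian_complex_structure br J"
      unfolding abelian_complex_structure_def using h16_bracket_torsion(2)[OF E] by blast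
    then show ?thesis
      using h16_bracket_iso[OF E] h16_bracket_nilpotent[OF E] h16_bracket_torsion(1)[OF E] lcskt
      by (simp add: nontrivial_lcskt_def)
  qed
qed

theorem corollary3p1:
  fixes br :: "'a::real_vector \<Rightarrow> 'a \<Rightarrow> 'a"
  assumes "lie_algebra br"
    and "dim (UNIV :: 'a set) = 6"
    and "nilpotent_lie br"
    and "\<not> abelian_lie br"
  shows "((\<exists>J g. lcskt br J g) \<longleftrightarrow> lie_isomorphic br h8 \<or> lie_isomorphic br h16) \<and>
    (lie_isomorphic br h8 \<longrightarrow>
       (\<forall>J g. lcskt br J g \<longrightarrow> abelian_complex_structure br J \<and> trivial_lcskt br J g)) \<and>
    (lie_isomorphic br h16 \<longrightarrow>
       (\<forall>J g. lcskt br J g \<longrightarrow>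
          nilpotent_complex_structure br J \<and> \<not> abelian_complex_structure br J \<and>
          nontrivial_lcskt br J g))"
proof -
  have "\<not> (lie_isomorphic br h8 \<and> lie_isomorphic br h16)"
    using lie_isomorphic_h8_two_step lie_isomorphic_h16_not_two_step by blast
  moreover have "\<exists>J g. lcskt br J g" if "lie_isomorphic br h8 \<or> lie_isomorphic br h16"
    using that lcskt_transport lcskt_h8 lcskt_h16 by blast
  ultimately show ?thesis using lcskt_dichotomy[OF assms] by blast
qed

end
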